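(* Let $d\geq 1$ be an integer. Then \[ M''(2t,2,d)\geq t(d+1)-1 \quad\text{for } t\geq 1,\qquad M''(2t+1,2,d)\geq t(d+1)\quad\text{for } t\geq 0. \] Moreover, these bounds are optimal (hold with equality) for $M''(n,2,1)$, $M''(3,2,d)$ and $M''(2,2,d)$; that is, $M''(n,2,1)=n-1$, $M''(3,2,d)=d+1$ and $M''(2,2,d)=d$.
   Context: All measures are probability measures on $\mathbb{R}^d$ absolutely continuous with respect to Lebesgue measure. A partition of $\mathbb{R}^d$ into $n$ parts formed by iterated hyperplane cuts is an ordered tuple $(K_1,\dots,K_n)$ of closed convex sets (some possibly empty) obtained by starting from the single part $\mathbb{R}^d$ and repeatedly choosing one existing part $C$ and replacing it by the two parts $C\cap H^+$ and $C\cap H^-$, where $H^+,H^-$ are the two closed half-spaces of an affine hyperplane (degenerate choices $\{H^+,H^-\}=\{\emptyset,\mathbb{R}^d\}$ allowed), until there are $n$ parts. An $r$-labeling is an arbitrary map $\ell\colon[n]\to[r]$. $M''(n,r,d)$ is the largest integer $M''$ such that for any $M''$ measures $\mu_1,\dots,\mu_{M''}$ on $\mathbb{R}^d$ there is a partition $(K_1,\dots,K_n)$ of $\mathbb{R}^d$ formed by iterated hyperplane cuts and a map $\ell\colon[n]\to[r]$ with $\mu_j\big(\bigcup_{i\in\ell^{-1}(s)}K_i\big)=\tfrac1r$ for all $1\le j\le M''$ and $1\le s\le r$. *)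

theory Defs
  imports "HOL-Probability.Probability" "HOL-Library.Extended_Nat"
begin

definition ac_prob_measure :: "'a::euclidean_space measure \<Rightarrow> bool" where
  "ac_prob_measure \<mu> \<longleftrightarrow> prob_space \<mu> \<and> sets \<mu> = sets lborel \<and> absolutely_continuous lborel \<mu>"

definition halfspace_pair :: "'a::euclidean_space set \<Rightarrow> 'a set \<Rightarrow> bool" where
  "halfspace_pair A B \<longleftrightarrow>
     (\<exists>a b. a \<noteq> 0 \<and> A = {x. a \<bullet> x \<ge> b} \<and> B = {x. a \<bullet> x \<le> b})
     \<or> (A = {} \<and> B = UNIV) \<or> (A = UNIV \<and> B = {})"

inductive cut_partition :: "'a::euclidean_space set list \<Rightarrow> bool" where
  base: "cut_partition [UNIV]"
| step: "cut_partition P \<Longrightarrow> i < length P \<Longrightarrow> halfspace_pair A B \<Longrightarrow>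
         cut_partition (P[i := P ! i \<inter> A] @ [P ! i \<inter> B])"
| reorder: "cut_partition P \<Longrightarrow> mset Q = mset P \<Longrightarrow> cut_partition Q"

definition equipartitionable :: "nat \<Rightarrow> nat \<Rightarrow> 'a::euclidean_space itself \<Rightarrow> nat \<Rightarrow> bool" where
  "equipartitionable n r T m \<longleftrightarrow>
     (\<forall>\<mu> :: nat \<Rightarrow> 'a measure. (\<forall>j<m. ac_prob_measure (\<mu> j)) \<longrightarrow>
        (\<exists>K lab. cut_partition K \<and> length K = n \<and> (\<forall>i<n. lab i < r) \<and>
           (\<forall>j<m. \<forall>s<r. measure (\<mu> j) (\<Union>i\<in>{i. i < n \<and> lab i = s}. K ! i) = 1 / real r)))"

text \<open>M''(n,r,d) with d = DIM('a), as the supremum in extended naturals (the largest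
such integer when it exists).\<close>
definition Mpp :: "nat \<Rightarrow> nat \<Rightarrow> 'a::euclidean_space itself \<Rightarrow> enat" where
  "Mpp n r T = Sup {enat m | m. equipartitionable n r T m}"

end

theory Submission
  imports Defs
begin

text \<open>
  Lower bounds. Cut space into parallel slabs, and cut each slab further by an affine function;
  the sign of that function is the label. Coefficient vectors of the affine functions form a
  sphere if the width of a slab is proportional to the size of its coefficients, so that a slab
  disappears exactly where its function becomes zero. The antipodal map exchanges the labels, and
  the Borsuk-Ulam theorem gives coefficients for which all differences of the two measures vanish.
  With one additional slab that stays uncut one gets the odd case.

  The Borsuk-Ulam theorem for the boundary of the cube is deduced from the octahedral Tucker lemma
  on sign vectors of length \<open>q (N + 1)\<close>: if the alternation number of a sign vector is within \<open>N\<close>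
  of its maximum, then one of its \<open>N + 1\<close> blocks of length \<open>q\<close> alternates perfectly, so the block
  means, taken with alternating signs, are a point of the boundary of the cube.

  Upper bounds. Take uniform measures on small balls. A hyperplane cannot meet balls around \<open>0\<close>
  and all basis vectors. Of three parts one forms a label class on its own; being convex and
  meeting balls around the vertices of a simplex, it contains a ball around an inner point. On the
  line, \<open>n\<close> disjoint balls contain \<open>n + 1\<close> consecutive points of alternating labels, which lie in
  distinct parts.
\<close>


subsection \<open>The octahedral Tucker lemma\<close>

fun alternating :: "bool \<Rightarrow> nat list \<Rightarrow> bool" where
  "alternating s [] \<longleftrightarrow> True"
| "alternating s (a # l) \<longleftrightarrow> even a = s \<and> alternating (\<not> s) l"

text \<open>Positions are counted, not resulting lists: each position is a facet of the simplex
  whose vertices carry the labels, and equal labels still give different facets.\<close>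

definition deletions :: "(nat list \<Rightarrow> bool) \<Rightarrow> nat list \<Rightarrow> nat" where
  "deletions P l = card {i. i < length l \<and> P (take i l @ drop (Suc i) l)}"

lemma deletions_Cons:
  "deletions P (a # l) = (if P l then 1 else 0) + deletions (\<lambda>l'. P (a # l')) l"
proof -
  let ?D = "{i. i < length l \<and> P (a # take i l @ drop (Suc i) l)}"
  have "{i. i < length (a # l) \<and> P (take i (a # l) @ drop (Suc i) (a # l))}
      = (if P l then {0} else {}) \<union> Suc ` ?D"
  proof (rule set_eqI)
    fix i show "i \<in> {i. i < length (a # l) \<and> P (take i (a # l) @ drop (Suc i) (a # l))}
      \<longleftrightarrow> i \<in> (if P l then {0} else {}) \<union> Suc ` ?D"
      by (cases i) auto
  qed
  moreover have "card ((if P l then {0} else {}) \<union> Suc ` ?D)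
      = (if P l then 1 else 0) + card (Suc ` ?D)"
    by (subst card_Un_disjoint) auto
  ultimately show ?thesis
    by (simp add: deletions_def card_image)
qed

text \<open>In an alternating list only the last or only the first entry can be deleted, depending
  on the starting sign. In any other list an entry whose deletion works has a neighbour of the same
  sign that can be deleted instead, so the number is 0 or 2. This is the local parity count behind
  Tucker's lemma.\<close>

lemma deletions_alternating:
  "l \<noteq> [] \<Longrightarrow> odd (deletions (alternating s) l) \<longleftrightarrow> alternating s l \<or> alternating (\<not> s) l"
proof -
  have "l \<noteq> [] \<longrightarrow> (if alternating s l \<or> alternating (\<not> s) l then deletions (alternating s) l = 1
     else deletions (alternating s) l \<in> {0, 2})"
  proof (induction l arbitrary: s)
    case Nil
    then show ?case by simp
  next
    case (Cons a l)
    have nil: "deletions P [] = 0" for P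
      by (simp add: deletions_def)
    have excl: "l \<noteq> [] \<Longrightarrow> alternating s l \<Longrightarrow> alternating (\<not> s) l \<Longrightarrow> False"
      by (cases l) auto
    have falsep: "deletions (\<lambda>l. False) l = 0"
      by (simp add: deletions_def)
    show ?case
    proof (cases "l = []")
      case True
      then show ?thesis by (auto simp: deletions_Cons nil)
    next
      case False
      then show ?thesis
        using Cons[of "\<not> s"] excl
        by (cases "even a = s") (auto simp: deletions_Cons falsep split: if_splits)
    qed
  qed
  then show "l \<noteq> [] \<Longrightarrow> ?thesis"
    by (auto split: if_splits)
qed

lemma sort_eqI: "sorted xs \<Longrightarrow> mset xs = mset ys \<Longrightarrow> sort ys = (xs :: nat list)"
  by (metis properties_for_sort)

lemma card_index_eq_sum_list:
  "card {i. i < length l \<and> P (l ! i)} = sum_list (map (\<lambda>a. if P a then 1 else 0) l)"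
proof (induction l)
  case (Cons a l)
  have "{i. i < length (a # l) \<and> P ((a # l) ! i)}
      = (if P a then {0} else {}) \<union> Suc ` {i. i < length l \<and> P (l ! i)}"
  proof (rule set_eqI)
    fix i show "i \<in> {i. i < length (a # l) \<and> P ((a # l) ! i)}
      \<longleftrightarrow> i \<in> (if P a then {0} else {}) \<union> Suc ` {i. i < length l \<and> P (l ! i)}"
      by (cases i) auto
  qed
  moreover have "card ((if P a then {0} else {}) \<union> Suc ` {i. i < length l \<and> P (l ! i)})
      = (if P a then 1 else 0) + card (Suc ` {i. i < length l \<and> P (l ! i)})"
    by (subst card_Un_disjoint) auto
  ultimately show ?case
    using Cons by (simp add: card_image)
qed simp

lemma mset_delete: "i < length l \<Longrightarrow> mset (take i l @ drop (Suc i) l) = mset l - {# l ! i #}"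
proof -
  assume "i < length l"
  then have "mset l = mset (take i l @ l ! i # drop (Suc i) l)"
    by (simp add: id_take_nth_drop[symmetric])
  then show ?thesis by simp
qed

text \<open>After sorting, a deletion is determined by the value removed from the multiset of
  entries, so both counts are sums over \<open>mset l\<close>. Labels come in the order of a flag,
  while alternation concerns their sorted list.\<close>

lemma deletions_sort:
  "deletions (\<lambda>l. P (sort l)) l = deletions P (sort l)"
proof -
  define Q where "Q a \<longleftrightarrow> P (sorted_list_of_multiset (mset l - {# a #}))" for a
  have 1: "sort (take i l @ drop (Suc i) l) = sorted_list_of_multiset (mset l - {# l ! i #})"
    if "i < length l" for i
    using mset_delete[OF that] sorted_list_of_multiset_mset[of "take i l @ drop (Suc i) l"] by argo
  have 2: "sorted_list_of_multiset (mset l - {#sort l ! i#}) = take i (sort l) @ drop (Suc i) (sort l)"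
    if i: "i < length (sort l)" for i
  proof -
    have "sorted (take i (sort l) @ sort l ! i # drop (Suc i) (sort l))"
      using id_take_nth_drop[OF i] sorted_sort[of l] by argo
    then have "sorted (take i (sort l) @ drop (Suc i) (sort l))"
      by (auto simp: sorted_append)
    then have "sort (take i (sort l) @ drop (Suc i) (sort l)) = take i (sort l) @ drop (Suc i) (sort l)"
      by (rule sorted_sort_id)
    then show ?thesis
      using mset_delete[OF i] sorted_list_of_multiset_mset[of "take i (sort l) @ drop (Suc i) (sort l)"]
      unfolding mset_sort by argo
  qed
  have "deletions (\<lambda>l. P (sort l)) l = card {i. i < length l \<and> Q (l ! i)}"
    unfolding deletions_def Q_def
    by (intro arg_cong[of _ _ card] Collect_cong conj_cong refl) (simp only: 1)
  also have "\<dots> = sum_list (map (\<lambda>a. if Q a then 1 else 0) l)"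
    by (rule card_index_eq_sum_list)
  also have "\<dots> = sum_mset (image_mset (\<lambda>a. if Q a then 1 else 0) (mset l))"
    by (simp only: mset_map[symmetric] sum_mset_sum_list)
  also have "\<dots> = sum_list (map (\<lambda>a. if Q a then 1 else 0) (sort l))"
    by (simp only: mset_sort[of "\<lambda>x. x" l, symmetric] mset_map[symmetric] sum_mset_sum_list)
  also have "\<dots> = card {i. i < length (sort l) \<and> Q (sort l ! i)}"
    by (rule card_index_eq_sum_list[symmetric])
  also have "\<dots> = deletions P (sort l)"
    unfolding deletions_def Q_def
    by (intro arg_cong[of _ _ card] Collect_cong conj_cong refl) (simp only: 2)
  finally show ?thesis .
qed

lemma even_card_involution:
  assumes "finite A" "\<And>x. x \<in> A \<Longrightarrow> g x \<in> A" "\<And>x. x \<in> A \<Longrightarrow> g (g x) = x"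
    "\<And>x. x \<in> A \<Longrightarrow> g x \<noteq> x"
  shows "even (card A)"
  using assms
proof (induction A rule: finite_psubset_induct)
  case (psubset A)
  show ?case
  proof (cases "A = {}")
    case False
    then obtain x where x: "x \<in> A" by auto
    let ?B = "A - {x, g x}"
    have "even (card ?B)"
    proof (rule psubset.IH)
      show "?B \<subset> A" using x by auto
      show "g y \<in> ?B" if "y \<in> ?B" for y
        using that psubset.prems(1,2)[of y] psubset.prems(2)[of x] x by auto
    qed (use psubset.prems in auto)
    moreover have "card A = card ?B + card {x, g x}"
      using x psubset.prems psubset.hyps card_Diff_subset[of "{x, g x}" A] card_mono[of A "{x, g x}"]
      by simp
    moreover have "card {x, g x} = 2"
      using x psubset.prems(3)[of x] by simp
    ultimately show ?thesis by simp
  qed simp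
qed


text \<open>A signed permutation \<open>w\<close> encodes the maximal chain of signed sets formed by the sets of its
  initial segments. The only other chain that shares all members with it except the \<open>i\<close>-th
  is that of \<open>toggle w i\<close>.\<close>

definition signed_perms :: "nat \<Rightarrow> int list set" where
  "signed_perms k = {w. length w = k \<and> distinct (map abs w) \<and> abs ` set w = {1..int k}}"

definition flag_labels :: "(int set \<Rightarrow> nat) \<Rightarrow> int list \<Rightarrow> nat list" where
  "flag_labels lam w = map (\<lambda>i. lam (set (take (Suc i) w))) [0..<length w]"

definition toggle :: "int list \<Rightarrow> nat \<Rightarrow> int list" where
  "toggle w i = (if Suc i < length w then w[i := w ! Suc i, Suc i := w ! i] else w[i := - w ! i])"

lemma finite_signed_perms: "finite (signed_perms k)"
proof (rule finite_subset)
  show "signed_perms k \<subseteq> {w. set w \<subseteq> {- int k..int k} \<and> length w = k}"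
  proof
    fix w assume "w \<in> signed_perms k"
    moreover then have "\<bar>x\<bar> \<in> {1..int k}" if "x \<in> set w" for x
      using that by (auto simp: signed_perms_def)
    ultimately show "w \<in> {w. set w \<subseteq> {- int k..int k} \<and> length w = k}"
      by (fastforce simp: signed_perms_def)
  qed
qed (simp add: finite_lists_length_eq)

lemma length_toggle [simp]: "length (toggle w i) = length w"
  by (simp add: toggle_def)

lemma toggle_toggle: "i < length w \<Longrightarrow> toggle (toggle w i) i = w"
  by (auto simp: toggle_def nth_list_update intro!: nth_equalityI)

lemma set_take_toggle:
  assumes "i < length w" "j < length w" "j \<noteq> i"
  shows "set (take (Suc j) (toggle w i)) = set (take (Suc j) w)"
proof (cases "j < i")
  case True
  then show ?thesis by (simp add: toggle_def)
next
  case False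
  \<comment> \<open>This forces \<open>i\<close> not to be the last position, so
    \<open>toggle\<close> swaps two entries within the prefix.\<close>
  then have j: "Suc i \<le> j" using assms by simp
  then have "take (Suc j) (toggle w i)
      = (take (Suc j) w)[i := take (Suc j) w ! Suc i, Suc i := take (Suc j) w ! i]"
    using assms by (simp add: toggle_def take_update_swap)
  then show ?thesis
    using j assms set_swap[of i "take (Suc j) w" "Suc i"] by simp
qed

text \<open>Flags that differ by a toggle share the facet obtained by dropping the
  \<open>i\<close>-th member. This is what makes \<open>toggle\<close> a pairing of facets.\<close>

lemma flag_labels_toggle:
  assumes "i < length w"
  shows "take i (flag_labels lam (toggle w i)) @ drop (Suc i) (flag_labels lam (toggle w i))
       = take i (flag_labels lam w) @ drop (Suc i) (flag_labels lam w)"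
proof -
  have "flag_labels lam (toggle w i) = (flag_labels lam w)[i := lam (set (take (Suc i) (toggle w i)))]"
    using assms set_take_toggle[OF assms]
    by (intro nth_equalityI) (auto simp: flag_labels_def nth_list_update)
  then show ?thesis by simp
qed

lemma mset_abs_toggle: "i < length w \<Longrightarrow> mset (map abs (toggle w i)) = mset (map abs w)"
proof (cases "Suc i < length w")
  case True
  assume "i < length w"
  with True have "mset (toggle w i) = mset w"
    by (simp add: toggle_def mset_swap)
  then show ?thesis by simp
next
  case False
  assume i: "i < length w"
  have "map abs (w[i := - w ! i]) = map abs w"
    using i by (intro nth_equalityI) (auto simp: nth_list_update)
  with False show ?thesis by (simp add: toggle_def)
qed

lemma toggle_signed_perms:
  assumes "w \<in> signed_perms k" "i < k"
  shows "toggle w i \<in> signed_perms k"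
proof -
  have m: "mset (map abs (toggle w i)) = mset (map abs w)"
    using assms by (intro mset_abs_toggle) (simp add: signed_perms_def)
  show ?thesis
    using assms mset_eq_imp_distinct_iff[OF m] mset_eq_setD[OF m]
    by (simp add: signed_perms_def)
qed

lemma signed_perms_uniq:
  assumes "w \<in> signed_perms k" "x \<in> set w" "- x \<in> set w"
  shows False
proof -
  have "inj_on abs (set w)"
    using assms(1) by (simp add: signed_perms_def distinct_map)
  then have "x = - x"
    using assms(2,3) by (metis abs_minus_cancel inj_onD)
  moreover have "\<bar>x\<bar> \<in> {1..int k}"
    using assms(1,2) by (auto simp: signed_perms_def)
  ultimately show False by simp
qed

text \<open>The upper hemisphere of the subdivided boundary of the cross-polytope: flags whose
  largest member contains \<open>+k\<close>.\<close>

definition upper_perms :: "nat \<Rightarrow> int list set" where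
  "upper_perms k = {w \<in> signed_perms k. int k \<in> set w}"

text \<open>These flags have a facet on the equator: dropping the largest member leaves a flag of
  the sphere one dimension lower.\<close>

lemma boundary_perms:
  "{w \<in> signed_perms (Suc k). w ! k = int (Suc k)} = (\<lambda>v. v @ [int (Suc k)]) ` signed_perms k"
proof (intro equalityI subsetI)
  fix w assume "w \<in> {w \<in> signed_perms (Suc k). w ! k = int (Suc k)}"
  then have w: "w \<in> signed_perms (Suc k)" "w ! k = int (Suc k)" by auto
  then have l: "length w = Suc k" by (simp add: signed_perms_def)
  define v where "v = take k w"
  have wv: "w = v @ [int (Suc k)]"
    using l w(2) by (metis lessI order_refl take_Suc_conv_app_nth take_all_iff v_def)
  have d: "distinct (map abs v)" "int (Suc k) \<notin> abs ` set v"
    using w(1) unfolding wv signed_perms_def by auto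
  have "insert (int (Suc k)) (abs ` set v) = {1..int (Suc k)}"
    using w(1) unfolding wv signed_perms_def by auto
  then have "abs ` set v = {1..int (Suc k)} - {int (Suc k)}"
    using d(2) by blast
  then have "abs ` set v = {1..int k}"
    by auto
  then have "v \<in> signed_perms k"
    using d(1) l by (simp add: signed_perms_def v_def)
  then show "w \<in> (\<lambda>v. v @ [int (Suc k)]) ` signed_perms k"
    using wv by blast
next
  fix w assume "w \<in> (\<lambda>v. v @ [int (Suc k)]) ` signed_perms k"
  then obtain v where v: "v \<in> signed_perms k" "w = v @ [int (Suc k)]" by auto
  have "abs ` set w = insert (int (Suc k)) {1..int k}"
    using v by (auto simp: signed_perms_def)
  also have "\<dots> = {1..int (Suc k)}" by auto
  finally show "w \<in> {w \<in> signed_perms (Suc k). w ! k = int (Suc k)}"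
    using v by (auto simp: signed_perms_def nth_append)
qed

lemma flag_labels_snoc: "flag_labels lam (v @ [x]) = flag_labels lam v @ [lam (set (v @ [x]))]"
  by (auto simp: flag_labels_def)

lemma length_flag_labels [simp]: "length (flag_labels lam w) = length w"
  by (simp add: flag_labels_def)

text \<open>Double counting of the chains with one member deleted whose labels alternate: \<open>toggle\<close> pairs
  them up, except for those that lie in the boundary of the upper hemisphere.\<close>

lemma parity_upper_perms:
  "even (card {w \<in> upper_perms (Suc k). alternating True (sort (flag_labels lam w))
        \<or> alternating False (sort (flag_labels lam w))})
   = even (card {v \<in> signed_perms k. alternating True (sort (flag_labels lam v))})"
proof -
  let ?del = "\<lambda>w i. take i (flag_labels lam w) @ drop (Suc i) (flag_labels lam w)"
  let ?U = "upper_perms (Suc k)"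
  define I where "I w = {i. i < Suc k \<and> alternating True (sort (?del w i))}" for w
  define D where "D = (SIGMA w:?U. I w)"
  \<comment> \<open>Toggling here would change \<open>Suc k\<close> into its negative and leave the
    upper hemisphere, so these pairs are kept out of the pairing.\<close>
  define D0 where "D0 = {(w, i) \<in> D. i = k \<and> w ! k = int (Suc k)}"
  have finU: "finite ?U"
    using finite_signed_perms[of "Suc k"] by (simp add: upper_perms_def)
  have finI: "finite (I w)" for w
    by (simp add: I_def)
  have finD: "finite D"
    using finU finI by (simp add: D_def)
  have len: "length w = Suc k" if "w \<in> ?U" for w
    using that by (simp add: upper_perms_def signed_perms_def)
  have cI: "even (card (I w)) \<longleftrightarrow> \<not> (alternating True (sort (flag_labels lam w))
        \<or> alternating False (sort (flag_labels lam w)))" if "w \<in> ?U" for w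
  proof -
    have "card (I w) = deletions (\<lambda>l. alternating True (sort l)) (flag_labels lam w)"
      using len[OF that] by (simp add: I_def deletions_def)
    also have "\<dots> = deletions (alternating True) (sort (flag_labels lam w))"
      by (rule deletions_sort)
    finally show ?thesis
      using deletions_alternating[of "sort (flag_labels lam w)" True] len[OF that]
      by (metis (full_types) Suc_not_Zero length_0_conv length_flag_labels length_sort)
  qed
  have "card D = (\<Sum>w\<in>?U. card (I w))"
    using finU finI by (simp add: D_def)
  \<comment> \<open>Modulo 2 only flags with an odd number of good facets count; by
    \<open>cI\<close> these are the alternating ones.\<close>
  then have "even (card D) \<longleftrightarrow> even (card {w \<in> ?U. odd (card (I w))})"
    by (simp add: even_sum_iff[OF finU])
  also have "{w \<in> ?U. odd (card (I w))} = {w \<in> ?U. alternating True (sort (flag_labels lam w))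
        \<or> alternating False (sort (flag_labels lam w))}"
    using cI by blast
  finally have 1: "even (card D) \<longleftrightarrow> even (card {w \<in> ?U. alternating True (sort (flag_labels lam w))
        \<or> alternating False (sort (flag_labels lam w))})" .
  have "even (card (D - D0))"
  proof (rule even_card_involution[where g = "\<lambda>(w, i). (toggle w i, i)"])
    show "finite (D - D0)" using finD by simp
  next
    fix x assume x: "x \<in> D - D0"
    then obtain w i where wi: "x = (w, i)" "w \<in> ?U" "i \<in> I w" "i < Suc k" "(w, i) \<notin> D0" "(w, i) \<in> D"
      by (auto simp: D_def I_def)
    have L: "length w = Suc k" using len wi by blast
    have sp: "w \<in> signed_perms (Suc k)" "int (Suc k) \<in> set w"
      using wi(2) by (auto simp: upper_perms_def)
    have t: "toggle w i \<in> signed_perms (Suc k)"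
      using toggle_signed_perms[OF sp(1) wi(4)] .
    \<comment> \<open>A swap keeps all entries. A sign change at the last position keeps
      \<open>Suc k\<close>, which stands elsewhere because the pair is not in
      \<open>D0\<close>.\<close>
    have kin: "int (Suc k) \<in> set (toggle w i)"
    proof (cases "Suc i < Suc k")
      case True
      then have "set (toggle w i) = set w"
        using L by (simp add: toggle_def set_swap)
      then show ?thesis using sp by simp
    next
      case False
      then have ik: "i = k" using wi(4) by simp
      have "w ! k \<noteq> int (Suc k)"
        using wi(5,6) ik by (auto simp: D0_def)
      moreover obtain j where j: "j < Suc k" "w ! j = int (Suc k)"
        using sp(2) L by (metis in_set_conv_nth)
      ultimately have "j \<noteq> k" by metis
      then have "toggle w i ! j = int (Suc k)"
        using j ik L by (simp add: toggle_def)
      then show ?thesis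
        using j L by (metis length_toggle nth_mem)
    qed
    have inD: "(toggle w i, i) \<in> D"
      using t kin wi(3) flag_labels_toggle[of i w lam] L wi(4)
      by (simp add: D_def I_def upper_perms_def)
    have notD0: "(toggle w i, i) \<notin> D0"
    proof
      assume "(toggle w i, i) \<in> D0"
      then have ik: "i = k" "toggle w i ! k = int (Suc k)" by (auto simp: D0_def)
      then have "w ! k = - int (Suc k)"
        using L by (simp add: toggle_def)
      then have "- int (Suc k) \<in> set w"
        using L by (metis lessI nth_mem)
      then show False
        using signed_perms_uniq[OF sp] by blast
    qed
    show "(case x of (w, i) \<Rightarrow> (toggle w i, i)) \<in> D - D0"
      using inD notD0 wi(1) by simp
    show "(case (case x of (w, i) \<Rightarrow> (toggle w i, i)) of (w, i) \<Rightarrow> (toggle w i, i)) = x"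
      using wi L by (simp add: toggle_toggle)
    have "toggle w i \<noteq> w"
    proof
      assume eq: "toggle w i = w"
      show False
      proof (cases "Suc i < Suc k")
        case True
        then have "w ! i = w ! Suc i"
          using eq L by (metis length_list_update nth_list_update_eq toggle_def)
        moreover have "distinct w"
          using sp(1) by (simp add: signed_perms_def distinct_map)
        ultimately show False
          using True L by (simp add: nth_eq_iff_index_eq)
      next
        case False
        then have "w ! i = - w ! i"
          using eq L wi(4) by (metis nth_list_update_eq toggle_def)
        then have "w ! i = 0" by simp
        moreover have "w ! i \<in> set w" using L wi(4) by simp
        ultimately show False
          using signed_perms_uniq[OF sp(1), of 0] by simp
      qed
    qed
    then show "(case x of (w, i) \<Rightarrow> (toggle w i, i)) \<noteq> x"
      using wi(1) by simp
  qed
  moreover have "card D = card (D - D0) + card D0"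
  proof -
    have "D0 \<subseteq> D" by (auto simp: D0_def)
    then show ?thesis
      using finD by (metis add.commute card_Diff_subset card_mono finite_subset le_add_diff_inverse)
  qed
  ultimately have 2: "even (card D) \<longleftrightarrow> even (card D0)" by simp
  let ?V = "{v \<in> signed_perms k. alternating True (sort (flag_labels lam v))}"
  \<comment> \<open>Deleting the last label of such a flag leaves exactly the labels of its
    equatorial flag \<open>v\<close>.\<close>
  have "D0 = (\<lambda>v. (v @ [int (Suc k)], k)) ` ?V"
  proof (intro equalityI subsetI)
    fix x assume "x \<in> D0"
    then obtain w where w: "x = (w, k)" "w \<in> ?U" "k \<in> I w" "w ! k = int (Suc k)"
      by (auto simp: D0_def D_def)
    then have "w \<in> {w \<in> signed_perms (Suc k). w ! k = int (Suc k)}"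
      by (simp add: upper_perms_def)
    then obtain v where v: "v \<in> signed_perms k" "w = v @ [int (Suc k)]"
      unfolding boundary_perms by blast
    moreover have "length v = k" using v by (simp add: signed_perms_def)
    ultimately show "x \<in> (\<lambda>v. (v @ [int (Suc k)], k)) ` ?V"
      using w by (auto simp: I_def flag_labels_snoc)
  next
    fix x assume "x \<in> (\<lambda>v. (v @ [int (Suc k)], k)) ` ?V"
    then obtain v where v: "v \<in> ?V" "x = (v @ [int (Suc k)], k)" by auto
    have L: "length v = k" using v by (simp add: signed_perms_def)
    have "v @ [int (Suc k)] \<in> {w \<in> signed_perms (Suc k). w ! k = int (Suc k)}"
      unfolding boundary_perms using v by blast
    then show "x \<in> D0"
      using v L by (auto simp: D0_def D_def I_def upper_perms_def flag_labels_snoc)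
  qed
  then have "card D0 = card ?V"
    by (simp add: card_image inj_on_def)
  with 1 2 show ?thesis by simp
qed

text \<open>Labels \<open>2 i\<close> and \<open>2 i + 1\<close> stand for the opposite labels \<open>+(i + 1)\<close> and \<open>-(i + 1)\<close> of Tucker's lemma.\<close>

definition flip :: "nat \<Rightarrow> nat" where
  "flip p = (if even p then Suc p else p - 1)"

lemma flip_flip [simp]: "flip (flip p) = p"
  unfolding flip_def by presburger

lemma even_flip [simp]: "even (flip p) \<longleftrightarrow> odd p"
  unfolding flip_def by presburger

lemma flip_mono: "p \<le> q \<Longrightarrow> q \<noteq> flip p \<Longrightarrow> flip p \<le> flip q"
  unfolding flip_def by presburger

lemma div2_eq_imp_flip: "p div 2 = q div 2 \<Longrightarrow> q = p \<or> q = flip p"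
  unfolding flip_def by presburger

lemma alternating_map_flip: "alternating s (map flip l) \<longleftrightarrow> alternating (\<not> s) l"
  by (induction l arbitrary: s) auto

text \<open>\<open>flip\<close> only exchanges the two members of each pair of opposite labels. It
  therefore preserves the order of labels that are not opposite.\<close>

lemma sort_map_flip:
  assumes "\<And>p q. p \<in> set l \<Longrightarrow> q \<in> set l \<Longrightarrow> q \<noteq> flip p"
  shows "sort (map flip l) = map flip (sort l)"
proof (rule sort_eqI)
  have "sorted_wrt (\<lambda>p q. flip p \<le> flip q) (sort l)"
    by (rule sorted_wrt_mono_rel[OF _ sorted_sort]) (use assms flip_mono in auto)
  then show "sorted (map flip (sort l))"
    by (simp add: sorted_map)
qed simp

text \<open>Equal entries of a sorted list would give neighbours of equal parity.\<close>

lemma alternating_sorted_distinct: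
  "alternating s l \<Longrightarrow> sorted l \<Longrightarrow> distinct l"
proof (induction l arbitrary: s)
  case (Cons a l)
  have "a \<notin> set l"
  proof (cases l)
    case (Cons b l')
    show ?thesis
    proof
      assume "a \<in> set l"
      then have "b \<le> a" "a \<le> b" using Cons.prems(2) Cons by auto
      then show False using Cons.prems(1) Cons by auto
    qed
  qed simp
  then show ?case using Cons by auto
qed simp

text \<open>Nonzero sign vectors of length \<open>n\<close>, given by their signed supports; these
  are the nonempty boundary faces of the cross-polytope.\<close>

definition signed_sets :: "nat \<Rightarrow> int set set" where
  "signed_sets n = {X. X \<noteq> {} \<and> (\<forall>x\<in>X. 1 \<le> \<bar>x\<bar> \<and> \<bar>x\<bar> \<le> int n \<and> - x \<notin> X)}"

lemma flag_signed_sets: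
  assumes "w \<in> signed_perms k" "k \<le> n" "i < k"
  shows "set (take (Suc i) w) \<in> signed_sets n"
proof -
  have "x \<in> set w" if "x \<in> set (take (Suc i) w)" for x
    using that by (meson in_set_takeD)
  moreover have "1 \<le> \<bar>x\<bar> \<and> \<bar>x\<bar> \<le> int n" if "x \<in> set w" for x
    using that assms(1,2) by (force simp: signed_perms_def)
  moreover have "set (take (Suc i) w) \<noteq> {}"
    using assms by (auto simp: signed_perms_def)
  ultimately show ?thesis
    using signed_perms_uniq[OF assms(1)] by (auto simp: signed_sets_def)
qed

text \<open>Fan's argument: in each dimension the flags whose sorted labels alternate, starting with
  a positive one, are odd in number. In dimension \<open>n\<close> such a flag has \<open>n\<close>
  labels, no two equal or opposite, and this needs at least \<open>n\<close> pairs of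
  labels.\<close>

theorem octahedral_tucker:
  fixes lam :: "int set \<Rightarrow> nat"
  assumes anti: "\<And>X. X \<in> signed_sets n \<Longrightarrow> lam (uminus ` X) = flip (lam X)"
    and nocomp: "\<And>X Y. X \<in> signed_sets n \<Longrightarrow> Y \<in> signed_sets n \<Longrightarrow> X \<subseteq> Y \<Longrightarrow> lam Y \<noteq> flip (lam X)"
    and bound: "\<And>X. X \<in> signed_sets n \<Longrightarrow> lam X < 2 * m"
  shows "n \<le> m"
proof -
  have nc: "q \<noteq> flip p" if w: "w \<in> signed_perms k" "k \<le> n"
    and pq: "p \<in> set (flag_labels lam w)" "q \<in> set (flag_labels lam w)" for w k p q
  proof -
    have L: "length w = k" using w by (simp add: signed_perms_def)
    obtain i j where ij: "i < k" "j < k" "p = lam (set (take (Suc i) w))" "q = lam (set (take (Suc j) w))"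
      using pq L by (auto simp: flag_labels_def)
    have si: "set (take (Suc i) w) \<in> signed_sets n" "set (take (Suc j) w) \<in> signed_sets n"
      using flag_signed_sets[OF w] ij by auto
    show ?thesis
    proof (cases "i \<le> j")
      case True
      then show ?thesis
        using nocomp[OF si] ij set_take_subset_set_take[of "Suc i" "Suc j" w] by simp
    next
      case False
      then have "lam (set (take (Suc i) w)) \<noteq> flip (lam (set (take (Suc j) w)))"
        using nocomp[OF si(2,1)] set_take_subset_set_take[of "Suc j" "Suc i" w] by simp
      then show ?thesis using ij by (metis flip_flip)
    qed
  qed
  have neg: "flag_labels lam (map uminus w) = map flip (flag_labels lam w)"
    if "w \<in> signed_perms k" "k \<le> n" for w k
  proof -
    have L: "length w = k" using that by (simp add: signed_perms_def)
    show ?thesis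
      using anti[OF flag_signed_sets[OF that]] L
      by (auto simp: flag_labels_def take_map)
  qed
  have "odd (card {v \<in> signed_perms k. alternating True (sort (flag_labels lam v))})" if "k \<le> n" for k
    using that
  proof (induction k)
    case 0
    have "signed_perms 0 = {[]}" by (auto simp: signed_perms_def)
    moreover have "alternating True (sort (flag_labels lam []))"
      by (simp add: flag_labels_def)
    ultimately have "{v \<in> signed_perms 0. alternating True (sort (flag_labels lam v))} = {[]}"
      by blast
    then show ?case by (simp only: card.empty card_insert_disjoint finite.emptyI empty_iff) simp
  next
    case (Suc k)
    let ?U = "upper_perms (Suc k)"
    let ?P = "\<lambda>s w. alternating s (sort (flag_labels lam w))"
    have fin: "finite ?U"
      using finite_signed_perms[of "Suc k"] by (simp add: upper_perms_def)
    \<comment> \<open>The induction hypothesis for the equator gives the parity for both first signs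
      together.\<close>
    have "odd (card {w \<in> ?U. ?P True w \<or> ?P False w})"
      using Suc parity_upper_perms[of k lam] by simp
    also have "{w \<in> ?U. ?P True w \<or> ?P False w} = {w \<in> ?U. ?P True w} \<union> {w \<in> ?U. ?P False w}"
      by auto
    also have "card \<dots> = card {w \<in> ?U. ?P True w} + card {w \<in> ?U. ?P False w}"
    proof (rule card_Un_disjoint)
      have "\<not> (?P True w \<and> ?P False w)" if "w \<in> ?U" for w
      proof -
        have "sort (flag_labels lam w) \<noteq> []"
          using that by (auto simp: upper_perms_def signed_perms_def simp flip: length_0_conv)
        then show ?thesis by (cases "sort (flag_labels lam w)") auto
      qed
      then show "{w \<in> ?U. ?P True w} \<inter> {w \<in> ?U. ?P False w} = {}" by blast
    qed (use fin in auto)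
    \<comment> \<open>The antipodal map exchanges both the signs and the hemispheres, so upper flags
      that start negative are replaced by lower flags that start positive.\<close>
    also have "card {w \<in> ?U. ?P False w} = card {w \<in> signed_perms (Suc k) - ?U. ?P True w}"
    proof (rule bij_betw_same_card[of "map uminus"], rule bij_betw_byWitness[where f' = "map uminus"])
      have mem: "map uminus w \<in> signed_perms (Suc k)" if "w \<in> signed_perms (Suc k)" for w
        using that by (auto simp: signed_perms_def image_image o_def)
      have pm: "?P s (map uminus w) \<longleftrightarrow> ?P (\<not> s) w" if "w \<in> signed_perms (Suc k)" for w s
        using neg[OF that Suc.prems] sort_map_flip[of "flag_labels lam w"] nc[OF that Suc.prems]
        by (simp add: alternating_map_flip)
      have upper: "int (Suc k) \<in> set (map uminus w) \<longleftrightarrow> int (Suc k) \<notin> set w"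
        if "w \<in> signed_perms (Suc k)" for w
      proof -
        have "int (Suc k) \<in> abs ` set w"
          using that by (simp add: signed_perms_def)
        then have "int (Suc k) \<in> set w \<or> - int (Suc k) \<in> set w"
          by (metis abs_if equation_minus_iff imageE)
        moreover have "int (Suc k) \<in> set (map uminus w) \<longleftrightarrow> - int (Suc k) \<in> set w"
          by (metis add.inverse_inverse image_eqI image_iff list.set_map)
        ultimately show ?thesis
          using signed_perms_uniq[OF that] by blast
      qed
      show "\<forall>a\<in>{w \<in> ?U. ?P False w}. map uminus (map uminus a) = a"
        "\<forall>a\<in>{w \<in> signed_perms (Suc k) - ?U. ?P True w}. map uminus (map uminus a) = a"
        by (simp_all only: map_map o_def minus_minus map_ident Ball_def simp_thms)
      have um: "w \<in> ?U \<longleftrightarrow> w \<in> signed_perms (Suc k) \<and> int (Suc k) \<in> set w" for w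
        by (simp only: upper_perms_def mem_Collect_eq)
      show "map uminus ` {w \<in> ?U. ?P False w} \<subseteq> {w \<in> signed_perms (Suc k) - ?U. ?P True w}"
      proof (rule image_subsetI)
        fix w assume w: "w \<in> {w \<in> ?U. ?P False w}"
        then have sp: "w \<in> signed_perms (Suc k)" by (simp add: um)
        from w show "map uminus w \<in> {w \<in> signed_perms (Suc k) - ?U. ?P True w}"
          unfolding mem_Collect_eq Diff_iff um pm[OF sp] upper[OF sp] using mem[OF sp] by simp
      qed
      show "map uminus ` {w \<in> signed_perms (Suc k) - ?U. ?P True w} \<subseteq> {w \<in> ?U. ?P False w}"
      proof (rule image_subsetI)
        fix w assume w: "w \<in> {w \<in> signed_perms (Suc k) - ?U. ?P True w}"
        then have sp: "w \<in> signed_perms (Suc k)" by (simp add: um)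
        from w show "map uminus w \<in> {w \<in> ?U. ?P False w}"
          unfolding mem_Collect_eq Diff_iff um pm[OF sp] upper[OF sp] using mem[OF sp] by simp
      qed
    qed
    also have "card {w \<in> ?U. ?P True w} + card {w \<in> signed_perms (Suc k) - ?U. ?P True w}
       = card ({w \<in> ?U. ?P True w} \<union> {w \<in> signed_perms (Suc k) - ?U. ?P True w})"
      using fin finite_signed_perms[of "Suc k"] by (intro card_Un_disjoint[symmetric]) auto
    also have "{w \<in> ?U. ?P True w} \<union> {w \<in> signed_perms (Suc k) - ?U. ?P True w}
      = {w \<in> signed_perms (Suc k). ?P True w}"
      by (auto simp: upper_perms_def)
    finally show ?case .
  qed
  then obtain w where w: "w \<in> signed_perms n" "alternating True (sort (flag_labels lam w))"
    by (metis (no_types, lifting) card.empty empty_Collect_eq even_zero order_refl)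
  define l where "l = flag_labels lam w"
  have L: "length w = n" using w by (simp add: signed_perms_def)
  have "distinct l"
    using alternating_sorted_distinct[OF w(2) sorted_sort] by (simp add: l_def)
  then have "card (set l) = n"
    using L by (simp add: distinct_card l_def)
  \<comment> \<open>Labels with the same half are equal or opposite, and opposite ones do not occur
    in a flag.\<close>
  moreover have "inj_on (\<lambda>p. p div 2) (set l)"
    using nc[OF w(1)] by (auto intro!: inj_onI simp: l_def dest!: div2_eq_imp_flip)
  ultimately have "n = card ((\<lambda>p. p div 2) ` set l)"
    by (simp add: card_image)
  also have "\<dots> \<le> card {..<m}"
  proof (rule card_mono)
    have "p < 2 * m" if "p \<in> set l" for p
      using that bound[OF flag_signed_sets[OF w(1)]] L by (auto simp: l_def flag_labels_def)
    then show "(\<lambda>p. p div 2) ` set l \<subseteq> {..<m}"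
      by (auto simp: less_mult_imp_div_less mult.commute)
  qed simp
  finally show ?thesis by simp
qed

subsection \<open>The Borsuk-Ulam theorem\<close>

text \<open>The alternation number of the first \<open>k\<close> entries, together with the last nonzero entry.\<close>

primrec alt_state :: "(nat \<Rightarrow> int) \<Rightarrow> nat \<Rightarrow> nat \<times> int" where
  "alt_state f 0 = (0, 0)"
| "alt_state f (Suc k) = (if f k = 0 \<or> f k = snd (alt_state f k) then alt_state f k
     else (Suc (fst (alt_state f k)), f k))"

definition sign_vector :: "(nat \<Rightarrow> int) \<Rightarrow> bool" where
  "sign_vector f \<longleftrightarrow> (\<forall>i. f i \<in> {-1, 0, 1})"

definition sign_le :: "(nat \<Rightarrow> int) \<Rightarrow> (nat \<Rightarrow> int) \<Rightarrow> bool" where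
  "sign_le f g \<longleftrightarrow> (\<forall>i. f i = 0 \<or> f i = g i)"

text \<open>Coordinates are counted from 0 but elements from 1, since 0 has no sign.\<close>

definition sign_of_set :: "int set \<Rightarrow> nat \<Rightarrow> int" where
  "sign_of_set X i = (if int (Suc i) \<in> X then 1 else if - int (Suc i) \<in> X then -1 else 0)"

lemma alt_state_uminus: "alt_state (\<lambda>i. - f i) k = (fst (alt_state f k), - snd (alt_state f k))"
  by (induction k) auto

text \<open>The induction has to carry the last nonzero entry along: if \<open>f\<close> catches up
  with \<open>g\<close> at an entry, that entry is the last sign of both. Equal alternation numbers
  thus force equal last signs, so comparable vectors with few alternations never get opposite
  labels.\<close>

lemma alt_state_mono:
  "sign_le f g \<Longrightarrow> fst (alt_state f k) < fst (alt_state g k) \<or> alt_state f k = alt_state g k"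
proof (induction k)
  case (Suc k)
  have "f k = 0 \<or> f k = g k" using Suc.prems by (simp add: sign_le_def)
  moreover have "snd (alt_state f k) = snd (alt_state g k)" "fst (alt_state f k) = fst (alt_state g k)"
    if "alt_state f k = alt_state g k"
    using that by simp_all
  ultimately show ?case using Suc by (auto simp: prod_eq_iff)
qed simp

lemma alt_state_le_nonzero: "fst (alt_state f k) \<le> card {i. i < k \<and> f i \<noteq> 0}"
proof (induction k)
  case (Suc k)
  have "{i. i < Suc k \<and> f i \<noteq> 0} = (if f k = 0 then {} else {k}) \<union> {i. i < k \<and> f i \<noteq> 0}"
    by (auto simp: less_Suc_eq)
  moreover have "card \<dots> = (if f k = 0 then 0 else 1) + card {i. i < k \<and> f i \<noteq> 0}"
    by (subst card_Un_disjoint) auto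
  ultimately show ?case using Suc by auto
qed simp

lemma snd_alt_state:
  "sign_vector f \<Longrightarrow> snd (alt_state f k) \<in> {-1, 0, 1} \<and> (snd (alt_state f k) = 0 \<longleftrightarrow> fst (alt_state f k) = 0)"
  by (induction k) (auto simp: sign_vector_def)

lemma alt_state_pos: "sign_vector f \<Longrightarrow> i < k \<Longrightarrow> f i \<noteq> 0 \<Longrightarrow> 0 < fst (alt_state f k)"
proof (induction k)
  case (Suc k)
  then show ?case
    using snd_alt_state[OF Suc.prems(1), of k] by (cases "i = k") auto
qed simp

lemma alt_state_add_le: "fst (alt_state f (m + q)) \<le> fst (alt_state f m) + q"
  by (induction q) auto

text \<open>Every entry raises the number by at most 1, so here each of the \<open>q\<close> entries
  does. It is then nonzero and differs from the last nonzero entry before it, which inside the block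
  is its predecessor.\<close>

lemma alt_state_full_block:
  assumes "sign_vector f" "fst (alt_state f (m + q)) = fst (alt_state f m) + q" "0 < q"
  shows "f m \<noteq> 0 \<and> (\<forall>i<q. f (m + i) = (-1) ^ i * f m) \<and> snd (alt_state f (m + q)) = f (m + (q - 1))"
  using assms(2,3)
proof (induction q)
  case (Suc q)
  have le: "fst (alt_state f (m + q)) \<le> fst (alt_state f m) + q" by (rule alt_state_add_le)
  have new: "f (m + q) \<noteq> 0" "f (m + q) \<noteq> snd (alt_state f (m + q))"
    "fst (alt_state f (m + q)) = fst (alt_state f m) + q"
    using Suc.prems le by (auto split: if_splits)
  have last: "snd (alt_state f (m + Suc q)) = f (m + q)"
    using new by simp
  show ?case
  proof (cases "q = 0")
    case True
    then show ?thesis using new last by simp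
  next
    case False
    then have IH: "f m \<noteq> 0" "\<And>i. i < q \<Longrightarrow> f (m + i) = (-1) ^ i * f m"
      "snd (alt_state f (m + q)) = f (m + (q - 1))"
      using Suc.IH new(3) by auto
    have "f (m + q) \<in> {-1, 0, 1}" "f (m + (q - 1)) \<in> {-1, 0, 1}"
      using assms(1) by (auto simp: sign_vector_def)
    moreover have "f (m + (q - 1)) \<noteq> 0"
      using IH(1) IH(2)[of "q - 1"] False by simp
    ultimately have "f (m + q) = - f (m + (q - 1))"
      using new IH(3) by auto
    also have "\<dots> = (-1) ^ q * f m"
      using IH(2)[of "q - 1"] False by (cases q) auto
    finally have "f (m + q) = (-1) ^ q * f m" .
    then show ?thesis
      using IH last by (auto simp: less_Suc_eq)
  qed
qed simp

text \<open>Pigeonhole: if each of the \<open>N + 1\<close> blocks lost at least one alternation,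
  the total would be at most \<open>q * Suc N - Suc N\<close>.\<close>

lemma exists_full_block:
  assumes "fst (alt_state f (q * Suc N)) \<ge> q * Suc N - N" "0 < q"
  shows "\<exists>b\<le>N. fst (alt_state f (b * q + q)) = fst (alt_state f (b * q)) + q"
proof (rule ccontr)
  assume "\<not> ?thesis"
  then have lt: "fst (alt_state f (b * q + q)) < fst (alt_state f (b * q)) + q" if "b \<le> N" for b
    using that alt_state_add_le[of f "b * q" q] by (metis le_neq_implies_less)
  have "fst (alt_state f (b * q)) + b \<le> b * q" if "b \<le> Suc N" for b
    using that
  proof (induction b)
    case (Suc b)
    then show ?case using lt[of b] by (simp add: add.commute)
  qed simp
  from this[of "Suc N"] have "fst (alt_state f (Suc N * q)) + Suc N \<le> Suc N * q" by blast
  then show False using assms(1) by (simp add: mult.commute)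
qed

text \<open>Vectors with few alternations are labelled by the sign of their last nonzero entry,
  the remaining ones by a dominant coordinate of \<open>G\<close>.\<close>

lemma complementary_sign_vectors:
  fixes G :: "(nat \<Rightarrow> int) \<Rightarrow> nat \<Rightarrow> real"
  assumes n: "N < n"
    and odd: "\<And>f j. G (\<lambda>i. - f i) j = - G f j"
    and nz: "\<And>f. sign_vector f \<Longrightarrow> fst (alt_state f n) \<ge> n - N \<Longrightarrow> \<exists>j<N. G f j \<noteq> 0"
  shows "\<exists>f g j. sign_vector f \<and> sign_vector g \<and> sign_le f g \<and>
    fst (alt_state f n) \<ge> n - N \<and> fst (alt_state g n) \<ge> n - N \<and> j < N \<and>
    G f j * G g j < 0 \<and> (\<forall>i<N. \<bar>G f i\<bar> \<le> \<bar>G f j\<bar>)"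
proof (rule ccontr)
  assume contra: "\<not> ?thesis"
  \<comment> \<open>The least index makes the choice depend on absolute values only, hence it is the
    same for \<open>f\<close> and its negative.\<close>
  define J where "J f = (LEAST j. j < N \<and> (\<forall>i<N. \<bar>G f i\<bar> \<le> \<bar>G f j\<bar>))" for f
  define high where "high f \<longleftrightarrow> fst (alt_state f n) \<ge> n - N" for f
  \<comment> \<open>Nonzero vectors with few alternations use the label pairs below
    \<open>n - N - 1\<close>, the others the \<open>N\<close> pairs from there on. Altogether these
    are \<open>n - 1\<close> pairs, one too few for Tucker's lemma.\<close>
  define lb where "lb f = (if high f then 2 * (n - N - 1 + J f) + (if G f (J f) > 0 then 0 else 1)
     else 2 * (fst (alt_state f n) - 1) + (if snd (alt_state f n) = 1 then 0 else 1))" for f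
  define lam where "lam X = lb (sign_of_set X)" for X
  have J: "J f < N \<and> (\<forall>i<N. \<bar>G f i\<bar> \<le> \<bar>G f (J f)\<bar>)" if "sign_vector f" "high f" for f
  proof -
    have "N \<noteq> 0" using nz[OF that(1)] that(2) by (auto simp: high_def)
    then have ne: "(\<lambda>i. \<bar>G f i\<bar>) ` {..<N} \<noteq> {}" by auto
    then obtain j where "j < N" "\<bar>G f j\<bar> = Max ((\<lambda>i. \<bar>G f i\<bar>) ` {..<N})"
      using Max_in[OF _ ne] by (metis (no_types, lifting) finite_imageI finite_lessThan imageE lessThan_iff)
    then have "j < N \<and> (\<forall>i<N. \<bar>G f i\<bar> \<le> \<bar>G f j\<bar>)" by auto
    then show ?thesis unfolding J_def by (rule LeastI)
  qed
  have Gnz: "G f (J f) \<noteq> 0" if "sign_vector f" "high f" for f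
    using J[OF that] nz[OF that(1)] that(2) by (fastforce simp: high_def)
  have Jneg: "J (\<lambda>i. - f i) = J f" for f
    by (simp add: J_def odd)
  have sv: "sign_vector (sign_of_set X)" for X
    by (simp add: sign_vector_def sign_of_set_def)
  have pos: "0 < fst (alt_state (sign_of_set X) n)" if X: "X \<in> signed_sets n" for X
  proof -
    obtain x where x: "x \<in> X" "1 \<le> \<bar>x\<bar>" "\<bar>x\<bar> \<le> int n"
      using X by (auto simp: signed_sets_def)
    define i where "i = nat (\<bar>x\<bar> - 1)"
    have i: "i < n" "int (Suc i) = \<bar>x\<bar>" using x by (auto simp: i_def)
    then have "sign_of_set X i \<noteq> 0"
      using x(1) by (auto simp: sign_of_set_def abs_if split: if_splits)
    then show ?thesis using alt_state_pos[OF sv i(1)] by blast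
  qed
  have neg: "sign_of_set (uminus ` X) = (\<lambda>i. - sign_of_set X i)" if "X \<in> signed_sets n" for X
  proof
    fix i
    have "int (Suc i) \<in> uminus ` X \<longleftrightarrow> - int (Suc i) \<in> X" "- int (Suc i) \<in> uminus ` X \<longleftrightarrow> int (Suc i) \<in> X"
      by (metis add.inverse_inverse imageE imageI)+
    moreover have "\<not> (int (Suc i) \<in> X \<and> - int (Suc i) \<in> X)"
      using that by (auto simp: signed_sets_def)
    ultimately show "sign_of_set (uminus ` X) i = - sign_of_set X i"
      by (simp add: sign_of_set_def)
  qed
  have "n \<le> n - 1"
  proof (rule octahedral_tucker[of n lam])
    fix X assume X: "X \<in> signed_sets n"
    let ?f = "sign_of_set X"
    have s: "snd (alt_state ?f n) \<in> {-1, 1}"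
      using snd_alt_state[OF sv, of X n] pos[OF X] by auto
    have hn: "high (\<lambda>i. - ?f i) = high ?f"
      by (simp add: high_def alt_state_uminus)
    show "lam (uminus ` X) = flip (lam X)"
    proof (cases "high ?f")
      case True
      then show ?thesis
        using Gnz[OF sv True] unfolding lam_def neg[OF X] lb_def hn
        by (auto simp: Jneg odd flip_def)
    next
      case False
      then show ?thesis
        using s unfolding lam_def neg[OF X] lb_def hn
        by (auto simp: alt_state_uminus flip_def)
    qed
    show "lam X < 2 * (n - 1)"
    proof (cases "high ?f")
      case True
      then show ?thesis using J[OF sv True] n by (auto simp: lam_def lb_def)
    next
      case False
      then show ?thesis using pos[OF X] n by (auto simp: lam_def lb_def high_def)
    qed
  next
    fix X Y assume X: "X \<in> signed_sets n" and Y: "Y \<in> signed_sets n" and XY: "X \<subseteq> Y"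
    let ?f = "sign_of_set X" and ?g = "sign_of_set Y"
    have le: "sign_le ?f ?g"
      unfolding sign_le_def
    proof
      fix i
      have "\<not> (int (Suc i) \<in> Y \<and> - int (Suc i) \<in> Y)"
        using Y by (auto simp: signed_sets_def)
      then show "?f i = 0 \<or> ?f i = ?g i"
        using XY by (auto simp: sign_of_set_def)
    qed
    show "lam Y \<noteq> flip (lam X)"
    proof
      assume eq: "lam Y = flip (lam X)"
      have d: "lam Y div 2 = lam X div 2" and p: "even (lam Y) \<longleftrightarrow> odd (lam X)"
        using eq unfolding flip_def by presburger+
      have dv: "lam X div 2 = (if high (sign_of_set X) then n - N - 1 + J (sign_of_set X)
            else fst (alt_state (sign_of_set X) n) - 1)" for X
        by (simp add: lam_def lb_def)
      have pv: "even (lam X) \<longleftrightarrow> (if high (sign_of_set X) then G (sign_of_set X) (J (sign_of_set X)) > 0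
            else snd (alt_state (sign_of_set X) n) = 1)" for X
        by (simp add: lam_def lb_def)
      \<comment> \<open>The two ranges of label pairs are disjoint, so both vectors are of the same
        kind.\<close>
      consider "high ?f" "high ?g" | "\<not> high ?f" "\<not> high ?g"
        using d pos[OF X] pos[OF Y] unfolding dv by (auto simp: high_def split: if_splits)
      then show False
      proof cases
        case 1
        then have J': "J ?g = J ?f" using d unfolding dv by simp
        have "G ?f (J ?f) * G ?g (J ?f) < 0"
          using p 1 J' Gnz[OF sv 1(1)] Gnz[OF sv 1(2)] unfolding pv
          by (auto simp: mult_less_0_iff)
        then show False
          using contra sv le 1 J[OF sv 1(1)] unfolding high_def by blast
      next
        case 2
        then have "fst (alt_state ?f n) = fst (alt_state ?g n)"
          using d pos[OF X] pos[OF Y] unfolding dv by auto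
        then have "alt_state ?f n = alt_state ?g n"
          using alt_state_mono[OF le, of n] by auto
        then show False using p 2 unfolding pv by auto
      qed
    qed
  qed
  then show False using n by simp
qed

text \<open>The \<open>N\<close>-sphere as the boundary of a cube with \<open>N + 1\<close>
  coordinates, placed inside the sequences so that the dimension can be a variable.\<close>

definition cube_boundary :: "nat \<Rightarrow> (nat \<Rightarrow> real) set" where
  "cube_boundary N = {z. (\<forall>b. \<bar>z b\<bar> \<le> 1) \<and> (\<forall>b>N. z b = 0) \<and> (\<exists>b\<le>N. \<bar>z b\<bar> = 1)}"

text \<open>The sign is that of the position in the whole vector; it makes a perfectly alternating
  block constant, with mean 1 or -1.\<close>

definition block_means :: "nat \<Rightarrow> nat \<Rightarrow> (nat \<Rightarrow> int) \<Rightarrow> nat \<Rightarrow> real" where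
  "block_means N q f b = (if b \<le> N then (\<Sum>i<q. (-1) ^ (b * q + i) * real_of_int (f (b * q + i))) / real q else 0)"

lemma block_means_uminus: "block_means N q (\<lambda>i. - f i) = (\<lambda>b. - block_means N q f b)"
  by (auto simp: block_means_def sum_negf)

lemma block_means_cube_boundary:
  assumes "sign_vector f" "fst (alt_state f (q * Suc N)) \<ge> q * Suc N - N" "0 < q"
  shows "block_means N q f \<in> cube_boundary N"
proof -
  have le: "\<bar>block_means N q f b\<bar> \<le> 1" for b
  proof (cases "b \<le> N")
    case True
    have "\<bar>\<Sum>i<q. (-1) ^ (b * q + i) * real_of_int (f (b * q + i))\<bar>
        \<le> (\<Sum>i<q. \<bar>(-1) ^ (b * q + i) * real_of_int (f (b * q + i))\<bar>)"
      by (rule sum_abs)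
    also have "\<dots> \<le> (\<Sum>i<q. 1)"
    proof (rule sum_mono)
      fix i
      have "f (b * q + i) \<in> {-1, 0, 1}" using assms(1) by (simp add: sign_vector_def)
      then show "\<bar>(-1) ^ (b * q + i) * real_of_int (f (b * q + i))\<bar> \<le> 1"
        by (auto simp: abs_mult power_abs)
    qed
    finally show ?thesis
      using True assms(3) by (simp add: block_means_def divide_le_eq)
  qed (simp add: block_means_def)
  obtain b where b: "b \<le> N" "fst (alt_state f (b * q + q)) = fst (alt_state f (b * q)) + q"
    using exists_full_block[OF assms(2,3)] by blast
  note blk = alt_state_full_block[OF assms(1) b(2) assms(3)]
  have "(\<Sum>i<q. (-1) ^ (b * q + i) * real_of_int (f (b * q + i)))
      = (\<Sum>i<q. (-1) ^ (b * q) * real_of_int (f (b * q)))"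
  proof (rule sum.cong[OF refl])
    fix i assume "i \<in> {..<q}"
    then have e: "f (b * q + i) = (-1) ^ i * f (b * q)" using blk by auto
    have "(-1::real) ^ i * (-1) ^ i = 1"
      by (simp flip: power_mult_distrib)
    then show "(-1) ^ (b * q + i) * real_of_int (f (b * q + i)) = (-1) ^ (b * q) * real_of_int (f (b * q))"
      unfolding e by (simp add: power_add algebra_simps)
  qed
  then have "block_means N q f b = (-1) ^ (b * q) * real_of_int (f (b * q))"
    using b assms(3) by (simp add: block_means_def)
  moreover have "f (b * q) \<in> {-1, 1}"
    using assms(1) blk by (auto simp: sign_vector_def)
  ultimately have "\<bar>block_means N q f b\<bar> = 1"
    by (auto simp: abs_mult power_abs)
  then show ?thesis
    using le b by (auto simp: cube_boundary_def block_means_def)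
qed

text \<open>The vectors differ only at zeros of \<open>f\<close>. Among the positions in question
  there are at most \<open>N\<close> of them, since the alternation number does not exceed the
  number of nonzero entries.\<close>

lemma block_means_close:
  assumes "sign_vector f" "sign_vector g" "sign_le f g" "0 < q"
    "fst (alt_state f (q * Suc N)) \<ge> q * Suc N - N"
  shows "\<bar>block_means N q f b - block_means N q g b\<bar> \<le> real N / real q"
proof (cases "b \<le> N")
  case True
  let ?n = "q * Suc N"
  let ?Z = "{i. i < ?n \<and> f i = 0}"
  have "card {i. i < ?n \<and> f i \<noteq> 0} + card ?Z = card ({i. i < ?n \<and> f i \<noteq> 0} \<union> ?Z)"
    by (rule card_Un_disjoint[symmetric]) auto
  also have "{i. i < ?n \<and> f i \<noteq> 0} \<union> ?Z = {..<?n}" by auto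
  finally have "card {i. i < ?n \<and> f i \<noteq> 0} + card ?Z = ?n" by simp
  then have cZ: "card ?Z \<le> N"
    using alt_state_le_nonzero[of f ?n] assms(5) by linarith
  have "(\<Sum>i<q. (-1) ^ (b * q + i) * real_of_int (f (b * q + i))) - (\<Sum>i<q. (-1) ^ (b * q + i) * real_of_int (g (b * q + i)))
     = (\<Sum>i<q. (-1) ^ (b * q + i) * real_of_int (f (b * q + i) - g (b * q + i)))"
    by (simp add: sum_subtractf algebra_simps)
  moreover have "\<bar>\<dots>\<bar> \<le> (\<Sum>i<q. if f (b * q + i) = 0 then 1 else 0)"
  proof (rule order_trans[OF sum_abs], rule sum_mono)
    fix i
    have "g (b * q + i) \<in> {-1, 0, 1}" "f (b * q + i) = 0 \<or> f (b * q + i) = g (b * q + i)"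
      using assms by (auto simp: sign_vector_def sign_le_def)
    then show "\<bar>(-1) ^ (b * q + i) * real_of_int (f (b * q + i) - g (b * q + i))\<bar> \<le> (if f (b * q + i) = 0 then 1 else 0)"
      by (auto simp: abs_mult power_abs)
  qed
  moreover have "(\<Sum>i<q. if f (b * q + i) = 0 then 1 else (0::real)) \<le> real N"
  proof -
    have "(\<Sum>i<q. if f (b * q + i) = 0 then 1 else (0::real)) = real (card {i. i < q \<and> f (b * q + i) = 0})"
      by (simp add: sum.If_cases Int_def)
    also have "card {i. i < q \<and> f (b * q + i) = 0} = card ((\<lambda>i. b * q + i) ` {i. i < q \<and> f (b * q + i) = 0})"
      by (simp add: card_image)
    also have "\<dots> \<le> card ?Z"
    proof (rule card_mono)
      have "b * q + i < ?n" if "i < q" for i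
      proof -
        have "b * q + i < b * q + q" using that by simp
        also have "\<dots> = Suc b * q" by simp
        also have "\<dots> \<le> Suc N * q" using True by (intro mult_right_mono) auto
        finally show ?thesis by (simp add: mult.commute)
      qed
      then show "(\<lambda>i. b * q + i) ` {i. i < q \<and> f (b * q + i) = 0} \<subseteq> ?Z" by auto
    qed simp
    finally show ?thesis using cZ by simp
  qed
  ultimately show ?thesis
    using True assms(4) by (simp add: block_means_def diff_divide_distrib[symmetric] divide_right_mono)
qed (simp add: block_means_def)

text \<open>Tychonoff for the cube of sequences in \<open>[-1, 1]\<close>, in sequential
  form.\<close>

lemma bounded_sequence_pointwise_convergent_subseq:
  fixes x :: "nat \<Rightarrow> nat \<Rightarrow> real"
  assumes "\<And>n b. \<bar>x n b\<bar> \<le> 1"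
  shows "\<exists>r z. strict_mono r \<and> (\<forall>b. (\<lambda>n. x (r n) b) \<longlonglongrightarrow> z b)"
proof -
  let ?K = "Pi\<^sub>E UNIV (\<lambda>_. {-1..1}) :: (nat \<Rightarrow> real) set"
  have "compact ?K"
    using compactin_PiE[of "\<lambda>_. euclidean :: real topology" UNIV "\<lambda>_::nat. {-1..1}"]
    by (simp add: euclidean_product_topology)
  then have "seq_compact ?K" by (rule compact_imp_seq_compact)
  moreover have "\<forall>n. x n \<in> ?K"
  proof (intro allI)
    fix n show "x n \<in> ?K" using assms[of n] by (auto simp: abs_le_iff minus_le_iff)
  qed
  ultimately obtain z r where r: "strict_mono r" "(x \<circ> r) \<longlonglongrightarrow> z"
    unfolding seq_compact_def by blast
  have "(\<lambda>n. x (r n) b) \<longlonglongrightarrow> z b" for b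
    using isCont_tendsto_compose[OF continuous_on_interior[OF continuous_on_product_coordinates[of b], of z] r(2)]
    by (simp add: o_def)
  then show ?thesis using r(1) by blast
qed

text \<open>Without a zero, sign vectors with blocks of length \<open>Suc m\<close> yield two points
  that differ by at most \<open>N / (m + 1)\<close> in each coordinate, and a component of
  \<open>F\<close> that dominates at the first point has opposite signs at the two. In a limit this
  component vanishes, and all others with it. Continuity is asked for only along sequences in the
  boundary, the form in which dominated convergence provides it.\<close>

theorem borsuk_ulam_cube:
  fixes F :: "(nat \<Rightarrow> real) \<Rightarrow> nat \<Rightarrow> real"
  assumes odd: "\<And>z j. F (\<lambda>b. - z b) j = - F z j"
    and cont: "\<And>x z j. j < N \<Longrightarrow> (\<And>n. x n \<in> cube_boundary N) \<Longrightarrow> z \<in> cube_boundary N \<Longrightarrow>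
      (\<And>b. (\<lambda>n. x n b) \<longlonglongrightarrow> z b) \<Longrightarrow> (\<lambda>n. F (x n) j) \<longlonglongrightarrow> F z j"
  shows "\<exists>z\<in>cube_boundary N. \<forall>j<N. F z j = 0"
proof (rule ccontr)
  assume "\<not> ?thesis"
  then have nz: "\<exists>j<N. F z j \<noteq> 0" if "z \<in> cube_boundary N" for z
    using that by blast
  have "\<exists>x y j. x \<in> cube_boundary N \<and> y \<in> cube_boundary N \<and> (\<forall>b. \<bar>x b - y b\<bar> \<le> real N / real (Suc m))
      \<and> j < N \<and> F x j * F y j < 0 \<and> (\<forall>i<N. \<bar>F x i\<bar> \<le> \<bar>F x j\<bar>)" for m
  proof -
    let ?q = "Suc m" let ?n = "?q * Suc N"
    have "N < ?n" by simp
    moreover have "F (block_means N ?q (\<lambda>i. - f i)) j = - F (block_means N ?q f) j" for f j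
      unfolding block_means_uminus by (rule odd)
    moreover have "\<exists>j<N. F (block_means N ?q f) j \<noteq> 0"
      if "sign_vector f" "fst (alt_state f ?n) \<ge> ?n - N" for f
      using nz[OF block_means_cube_boundary[OF that]] by simp
    ultimately have "\<exists>f g j. sign_vector f \<and> sign_vector g \<and> sign_le f g \<and>
      fst (alt_state f ?n) \<ge> ?n - N \<and> fst (alt_state g ?n) \<ge> ?n - N \<and> j < N \<and>
      F (block_means N ?q f) j * F (block_means N ?q g) j < 0 \<and>
      (\<forall>i<N. \<bar>F (block_means N ?q f) i\<bar> \<le> \<bar>F (block_means N ?q f) j\<bar>)"
      by (rule complementary_sign_vectors[where G = "\<lambda>f. F (block_means N ?q f)"])
    then obtain f g j where fg: "sign_vector f" "sign_vector g" "sign_le f g"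
      "fst (alt_state f ?n) \<ge> ?n - N" "fst (alt_state g ?n) \<ge> ?n - N" and j: "j < N"
      "F (block_means N ?q f) j * F (block_means N ?q g) j < 0"
      "\<forall>i<N. \<bar>F (block_means N ?q f) i\<bar> \<le> \<bar>F (block_means N ?q f) j\<bar>"
      by blast
    have "block_means N ?q f \<in> cube_boundary N" "block_means N ?q g \<in> cube_boundary N"
      "\<forall>b. \<bar>block_means N ?q f b - block_means N ?q g b\<bar> \<le> real N / real ?q"
      using block_means_cube_boundary block_means_close fg by blast+
    then show ?thesis using j by blast
  qed
  then obtain x y j where xy: "\<And>m. x m \<in> cube_boundary N" "\<And>m. y m \<in> cube_boundary N"
    "\<And>m b. \<bar>x m b - y m b\<bar> \<le> real N / real (Suc m)" "\<And>m. j m < N" "\<And>m. F (x m) (j m) * F (y m) (j m) < 0"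
    "\<And>m i. i < N \<Longrightarrow> \<bar>F (x m) i\<bar> \<le> \<bar>F (x m) (j m)\<bar>"
    by metis
  have "\<exists>c. c \<le> N \<and> \<bar>x m c\<bar> = 1" for m
    using xy(1)[of m] by (simp add: cube_boundary_def)
  then obtain c where c: "\<And>m. c m \<le> N" "\<And>m. \<bar>x m (c m)\<bar> = 1" by metis
  \<comment> \<open>Only finitely many pairs of a dominating component \<open>j m\<close> and a face
    \<open>c m\<close> occur, so both can be fixed along a subsequence. Fixing the face keeps the
    limit in the boundary.\<close>
  have "finite ((\<lambda>m. (j m, c m)) ` UNIV)"
    by (rule finite_subset[of _ "{..N} \<times> {..N}"]) (use xy(4) c(1) in \<open>auto intro: less_imp_le\<close>)
  then obtain m0 where "infinite {m. (j m, c m) = (j m0, c m0)}"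
    using pigeonhole_infinite[OF infinite_UNIV_nat, of "\<lambda>m. (j m, c m)"] by auto
  then obtain s :: "nat \<Rightarrow> nat" where s: "strict_mono s" "\<And>m. s m \<in> {m. (j m, c m) = (j m0, c m0)}"
    using infinite_enumerate by blast
  have "\<bar>x (s m) b\<bar> \<le> 1" for m b
    using xy(1)[of "s m"] by (simp add: cube_boundary_def)
  then obtain r z where r: "strict_mono r" "\<And>b. (\<lambda>m. x (s (r m)) b) \<longlonglongrightarrow> z b"
    using bounded_sequence_pointwise_convergent_subseq[of "\<lambda>m. x (s m)"] by blast
  define t where "t m = s (r m)" for m
  have t: "strict_mono t" "\<And>m. j (t m) = j m0" "\<And>m. c (t m) = c m0"
    using s r(1) by (auto simp: t_def strict_mono_def)
  have lx: "(\<lambda>m. x (t m) b) \<longlonglongrightarrow> z b" for b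
    using r(2) by (simp add: t_def)
  have "(\<lambda>m. real N / real (Suc m)) \<longlonglongrightarrow> 0"
    by (rule LIMSEQ_Suc[OF lim_const_over_n])
  then have "(\<lambda>m. real N / real (Suc (t m))) \<longlonglongrightarrow> 0"
    using LIMSEQ_subseq_LIMSEQ[OF _ t(1)] by (auto simp: o_def)
  then have d: "(\<lambda>m. x (t m) b - y (t m) b) \<longlonglongrightarrow> 0" for b
    by (rule Lim_null_comparison[rotated]) (use xy(3) in auto)
  have ly: "(\<lambda>m. y (t m) b) \<longlonglongrightarrow> z b" for b
    using tendsto_diff[OF lx[of b] d[of b]] by simp
  have "z \<in> cube_boundary N"
    unfolding cube_boundary_def
  proof (intro CollectI conjI allI impI)
    fix b
    have "\<bar>x (t m) b\<bar> \<le> 1" for m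
      using xy(1)[of "t m"] by (simp add: cube_boundary_def)
    then show "\<bar>z b\<bar> \<le> 1"
      by (intro LIMSEQ_le_const2[OF tendsto_rabs[OF lx]]) auto
  next
    fix b assume "N < b"
    then have "x (t m) b = 0" for m
      using xy(1)[of "t m"] by (simp add: cube_boundary_def)
    then show "z b = 0"
      using lx[of b] by (simp add: LIMSEQ_const_iff)
  next
    have "(\<lambda>m. \<bar>x (t m) (c m0)\<bar>) \<longlonglongrightarrow> \<bar>z (c m0)\<bar>"
      by (rule tendsto_rabs[OF lx])
    moreover have "\<bar>x (t m) (c m0)\<bar> = 1" for m
      using c(2)[of "t m"] t(3) by simp
    ultimately have "\<bar>z (c m0)\<bar> = 1"
      by (simp add: LIMSEQ_const_iff)
    then show "\<exists>b\<le>N. \<bar>z b\<bar> = 1" using c(1) by blast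
  qed
  note z = this
  have Fx: "(\<lambda>m. F (x (t m)) i) \<longlonglongrightarrow> F z i" if "i < N" for i
    using cont[OF that _ z lx] xy(1) by simp
  have Fy: "(\<lambda>m. F (y (t m)) i) \<longlonglongrightarrow> F z i" if "i < N" for i
    using cont[OF that _ z ly] xy(2) by simp
  have jN: "j m0 < N" using xy(4) by blast
  \<comment> \<open>The products are negative, and both factors have the same limit.\<close>
  have "F z (j m0) * F z (j m0) \<le> 0"
    using xy(5) t(2) by (intro LIMSEQ_le_const2[OF tendsto_mult[OF Fx[OF jN] Fy[OF jN]]])
      (metis less_imp_le)
  then have F0: "F z (j m0) = 0"
    by (metis mult_eq_0_iff order_antisym zero_le_square)
  have "F z i = 0" if "i < N" for i
  proof -
    have "\<bar>F z i\<bar> \<le> \<bar>F z (j m0)\<bar>"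
      using xy(6)[OF that] t(2)
      by (intro LIMSEQ_le[OF tendsto_rabs[OF Fx[OF that]] tendsto_rabs[OF Fx[OF jN]]]) metis
    then show ?thesis using F0 by simp
  qed
  then show False using nz[OF z] by blast
qed

subsection \<open>Lower bounds\<close>

lemma AE_not_hyperplane:
  fixes a :: "'a::euclidean_space"
  assumes "ac_prob_measure \<mu>" "a \<noteq> 0 \<or> b \<noteq> 0"
  shows "AE p in \<mu>. a \<bullet> p \<noteq> b"
proof (cases "a = 0")
  case True
  then show ?thesis using assms(2) by simp
next
  case False
  then have "negligible {p. a \<bullet> p = b}"
    by (intro negligible_hyperplane) simp
  then have "{p. a \<bullet> p = b} \<in> null_sets lborel"
    using closed_hyperplane[of a b] by (simp add: negligible_iff_null_sets null_sets_completion_iff borel_closed)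
  then have "{p. a \<bullet> p = b} \<in> null_sets \<mu>"
    using assms(1) by (auto simp: ac_prob_measure_def absolutely_continuous_def)
  then show ?thesis
    by (rule AE_I') auto
qed

text \<open>One coordinate is squeezed into the open unit interval, so that all borders of slabs,
  including those at infinity, have finite levels.\<close>

definition slab_coord :: "'a::euclidean_space \<Rightarrow> real" where
  "slab_coord p = arctan ((SOME e. e \<in> Basis) \<bullet> p) / pi + 1 / 2"

lemma slab_coord_bounds: "0 < slab_coord p" "slab_coord p < 1"
  using arctan_bounded[of "(SOME e. e \<in> Basis) \<bullet> p"] by (auto simp: slab_coord_def field_simps)

lemma continuous_on_slab_coord [continuous_intros]: "continuous_on S slab_coord"
  unfolding slab_coord_def by (intro continuous_intros) simp

lemma slab_coord_cmp:
  assumes "0 < u" "u < 1"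
  shows "\<exists>c. \<forall>p :: 'a::euclidean_space. (slab_coord p \<le> u \<longleftrightarrow> (SOME e. e \<in> Basis) \<bullet> p \<le> c)
    \<and> (u \<le> slab_coord p \<longleftrightarrow> c \<le> (SOME e. e \<in> Basis) \<bullet> p)"
proof (intro exI allI)
  let ?c = "tan (pi * (u - 1 / 2))"
  have "- (pi / 2) < pi * (u - 1 / 2)" "pi * (u - 1 / 2) < pi / 2"
    using assms by (auto simp: field_simps)
  then have c: "arctan ?c = pi * (u - 1 / 2)"
    by (rule arctan_tan)
  fix p :: 'a
  let ?x = "(SOME e. e \<in> Basis) \<bullet> p"
  have "slab_coord p \<le> u \<longleftrightarrow> arctan ?x \<le> arctan ?c" "u \<le> slab_coord p \<longleftrightarrow> arctan ?c \<le> arctan ?x"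
    unfolding c slab_coord_def by (auto simp: field_simps)
  then show "(slab_coord p \<le> u \<longleftrightarrow> ?x \<le> ?c) \<and> (u \<le> slab_coord p \<longleftrightarrow> ?c \<le> ?x)"
    by (simp_all add: arctan_le_iff)
qed

lemma some_Basis_nonzero: "(SOME e :: 'a::euclidean_space. e \<in> Basis) \<noteq> 0"
  using SOME_Basis nonzero_Basis by metis

text \<open>A level outside the open unit interval gives one of the degenerate cuts.\<close>

lemma halfspace_pair_slab_coord:
  "halfspace_pair {p :: 'a::euclidean_space. slab_coord p \<le> u} {p. u \<le> slab_coord p}"
proof -
  consider "u \<le> 0" | "1 \<le> u" | "0 < u" "u < 1" by linarith
  then show ?thesis
  proof cases
    case 1
    then have "{p :: 'a. slab_coord p \<le> u} = {}" "{p :: 'a. u \<le> slab_coord p} = UNIV"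
      using slab_coord_bounds(1)[where 'a = 'a] by (auto simp: not_le intro: order_le_less_trans order_trans less_imp_le)
    then show ?thesis by (simp add: halfspace_pair_def)
  next
    case 2
    then have "{p :: 'a. slab_coord p \<le> u} = UNIV" "{p :: 'a. u \<le> slab_coord p} = {}"
      using slab_coord_bounds(2)[where 'a = 'a] by (auto simp: not_le intro: order_less_le_trans order_trans less_imp_le)
    then show ?thesis by (simp add: halfspace_pair_def)
  next
    case 3
    then obtain c where c: "\<And>p :: 'a. slab_coord p \<le> u \<longleftrightarrow> (SOME e. e \<in> Basis) \<bullet> p \<le> c"
      "\<And>p :: 'a. u \<le> slab_coord p \<longleftrightarrow> c \<le> (SOME e. e \<in> Basis) \<bullet> p"
      using slab_coord_cmp[where 'a = 'a] by blast
    let ?e = "- (SOME e. e \<in> Basis) :: 'a"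
    have "?e \<noteq> 0 \<and> {p :: 'a. slab_coord p \<le> u} = {p. - c \<le> ?e \<bullet> p} \<and> {p :: 'a. u \<le> slab_coord p} = {p. ?e \<bullet> p \<le> - c}"
      using some_Basis_nonzero by (auto simp: c)
    then show ?thesis unfolding halfspace_pair_def by blast
  qed
qed

lemma AE_slab_coord_neq:
  fixes \<mu> :: "'a::euclidean_space measure"
  assumes "ac_prob_measure \<mu>"
  shows "AE p in \<mu>. slab_coord p \<noteq> u"
proof (cases "0 < u \<and> u < 1")
  case True
  then obtain c where c: "\<And>p :: 'a. slab_coord p \<le> u \<longleftrightarrow> (SOME e. e \<in> Basis) \<bullet> p \<le> c"
    "\<And>p :: 'a. u \<le> slab_coord p \<longleftrightarrow> c \<le> (SOME e. e \<in> Basis) \<bullet> p"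
    using slab_coord_cmp[where 'a = 'a] by blast
  have "AE p in \<mu>. (SOME e. e \<in> Basis) \<bullet> p \<noteq> c"
    using some_Basis_nonzero by (intro AE_not_hyperplane[OF assms]) auto
  then show ?thesis
    by eventually_elim (metis c eq_iff)
next
  case False
  then have "slab_coord p \<noteq> u" for p :: 'a
    using slab_coord_bounds[of p] by auto
  then show ?thesis by simp
qed

definition weight :: "(nat \<Rightarrow> 'a::euclidean_space) \<Rightarrow> (nat \<Rightarrow> real) \<Rightarrow> nat \<Rightarrow> real" where
  "weight A B s = norm (A s) + \<bar>B s\<bar>"

text \<open>Slab \<open>s\<close> lies between the levels with indices \<open>s\<close> and
  \<open>Suc s\<close>. If the total weight is positive, the levels run from 0 to 1.\<close>

definition cut_level :: "(nat \<Rightarrow> 'a::euclidean_space) \<Rightarrow> (nat \<Rightarrow> real) \<Rightarrow> nat \<Rightarrow> nat \<Rightarrow> real" where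
  "cut_level A B T s = (\<Sum>r<s. weight A B r) / (\<Sum>r<T. weight A B r)"

text \<open>For the partitions below this is almost everywhere 1 on the class with label 0 and -1 on
  the class with label 1, so its integral is the difference of their measures.\<close>

definition signed_density :: "(nat \<Rightarrow> 'a::euclidean_space) \<Rightarrow> (nat \<Rightarrow> real) \<Rightarrow> nat \<Rightarrow> 'a \<Rightarrow> real" where
  "signed_density A B T p = (\<Sum>s<T. if cut_level A B T s < slab_coord p \<and> slab_coord p < cut_level A B T (Suc s)
     then sgn (A s \<bullet> p + B s) else 0)"

text \<open>The conditions fail only on a null set. A function of weight 0 is exempt because it
  vanishes everywhere.\<close>

definition generic :: "(nat \<Rightarrow> 'a::euclidean_space) \<Rightarrow> (nat \<Rightarrow> real) \<Rightarrow> nat \<Rightarrow> 'a \<Rightarrow> bool" where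
  "generic A B T p \<longleftrightarrow> (\<forall>s\<le>T. slab_coord p \<noteq> cut_level A B T s) \<and>
     (\<forall>s<T. weight A B s > 0 \<longrightarrow> A s \<bullet> p + B s \<noteq> 0)"

lemma weight_nonneg: "0 \<le> weight A B s"
  by (simp add: weight_def)

lemma cut_level_uminus: "cut_level (\<lambda>s. - A s) (\<lambda>s. - B s) T s = cut_level A B T s"
  by (simp add: cut_level_def weight_def)

lemma signed_density_uminus: "signed_density (\<lambda>s. - A s) (\<lambda>s. - B s) T p = - signed_density A B T p"
proof -
  have "sgn (- A s \<bullet> p + - B s) = - sgn (A s \<bullet> p + B s)" for s
    using sgn_minus[of "A s \<bullet> p + B s"] by (simp add: algebra_simps)
  then show ?thesis
    unfolding signed_density_def cut_level_uminus sum_negf[symmetric]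
    by (intro sum.cong) auto
qed

lemma AE_generic:
  assumes "ac_prob_measure \<mu>"
  shows "AE p in \<mu>. generic A B T p"
proof -
  have "AE p in \<mu>. \<forall>s\<in>{..T}. slab_coord p \<noteq> cut_level A B T s"
    by (intro AE_finite_allI AE_slab_coord_neq assms) simp
  moreover have "AE p in \<mu>. \<forall>s\<in>{..<T}. weight A B s > 0 \<longrightarrow> A s \<bullet> p + B s \<noteq> 0"
  proof (intro AE_finite_allI)
    fix s
    show "AE p in \<mu>. weight A B s > 0 \<longrightarrow> A s \<bullet> p + B s \<noteq> 0"
    proof (cases "weight A B s > 0")
      case True
      then have "A s \<noteq> 0 \<or> - B s \<noteq> 0" by (auto simp: weight_def)
      from AE_not_hyperplane[OF assms this] show ?thesis
        by eventually_elim (simp add: eq_neg_iff_add_eq_0)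
    qed simp
  qed simp
  ultimately show ?thesis
    by eventually_elim (auto simp: generic_def)
qed

lemma weight_pos_if_level_less:
  assumes "cut_level A B T s < cut_level A B T (Suc s)"
  shows "0 < weight A B s"
  using assms weight_nonneg[of A B s] by (cases "weight A B s = 0") (auto simp: cut_level_def)

lemma tendsto_cut_level:
  assumes "\<And>s. (\<lambda>n. A' n s) \<longlonglongrightarrow> A s" "\<And>s. (\<lambda>n. B' n s) \<longlonglongrightarrow> B s" "0 < (\<Sum>r<T. weight A B r)"
  shows "(\<lambda>n. cut_level (A' n) (B' n) T s) \<longlonglongrightarrow> cut_level A B T s"
proof -
  have "(\<lambda>n. weight (A' n) (B' n) r) \<longlonglongrightarrow> weight A B r" for r
    unfolding weight_def by (intro tendsto_intros assms)
  then show ?thesis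
    unfolding cut_level_def using assms(3) by (intro tendsto_intros) auto
qed

text \<open>At a generic point strict inequalities decide whether it lies in a slab, and they
  persist for nearby coefficients. If it does, the slab has positive width, so its function is
  nonzero at the point and keeps its sign.\<close>

lemma tendsto_signed_density:
  assumes "\<And>s. (\<lambda>n. A' n s) \<longlonglongrightarrow> A s" "\<And>s. (\<lambda>n. B' n s) \<longlonglongrightarrow> B s" "0 < (\<Sum>r<T. weight A B r)"
    and gen: "generic A B T p"
  shows "(\<lambda>n. signed_density (A' n) (B' n) T p) \<longlonglongrightarrow> signed_density A B T p"
  unfolding signed_density_def
proof (rule tendsto_sum)
  fix s assume s: "s \<in> {..<T}"
  let ?u = "\<lambda>n. cut_level (A' n) (B' n) T s" and ?v = "\<lambda>n. cut_level (A' n) (B' n) T (Suc s)"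
  let ?t = "\<lambda>n. if ?u n < slab_coord p \<and> slab_coord p < ?v n then sgn (A' n s \<bullet> p + B' n s) else 0"
  note u = tendsto_cut_level[OF assms(1-3), of s] and v = tendsto_cut_level[OF assms(1-3), of "Suc s"]
  have ne: "slab_coord p \<noteq> cut_level A B T s" "slab_coord p \<noteq> cut_level A B T (Suc s)"
    using gen s by (auto simp: generic_def)
  consider "cut_level A B T s < slab_coord p" "slab_coord p < cut_level A B T (Suc s)"
    | "slab_coord p < cut_level A B T s" | "cut_level A B T (Suc s) < slab_coord p"
    using ne by linarith
  then show "?t \<longlonglongrightarrow> (if cut_level A B T s < slab_coord p \<and> slab_coord p < cut_level A B T (Suc s)
     then sgn (A s \<bullet> p + B s) else 0)"
  proof cases
    case 1
    then have "A s \<bullet> p + B s \<noteq> 0"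
      using gen s weight_pos_if_level_less[of A B T s] by (auto simp: generic_def)
    then have "(\<lambda>n. sgn (A' n s \<bullet> p + B' n s)) \<longlonglongrightarrow> sgn (A s \<bullet> p + B s)"
      by (intro tendsto_intros assms)
    moreover have "\<forall>\<^sub>F n in sequentially. sgn (A' n s \<bullet> p + B' n s) = ?t n"
      using order_tendstoD(2)[OF u 1(1)] order_tendstoD(1)[OF v 1(2)] by eventually_elim simp
    ultimately show ?thesis
      using 1 by (simp add: tendsto_cong)
  next
    case 2
    have "\<forall>\<^sub>F n in sequentially. ?t n = 0"
      using order_tendstoD(1)[OF u 2] by eventually_elim simp
    then show ?thesis using 2 by (simp add: tendsto_eventually)
  next
    case 3
    have "\<forall>\<^sub>F n in sequentially. ?t n = 0"
      using order_tendstoD(2)[OF v 3] by eventually_elim simp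
    then show ?thesis using 3 by (simp add: tendsto_eventually)
  qed
qed

lemma cut_level_mono:
  assumes "s \<le> r"
  shows "cut_level A B T s \<le> cut_level A B T r"
  unfolding cut_level_def
  by (intro divide_right_mono sum_mono2 sum_nonneg weight_nonneg) (use assms in auto)

lemma exists_slab:
  assumes "0 < (\<Sum>r<T. weight A B r)" "generic A B T p"
  shows "\<exists>s<T. cut_level A B T s < slab_coord p \<and> slab_coord p < cut_level A B T (Suc s)"
proof -
  define s where "s = (LEAST s. slab_coord p < cut_level A B T (Suc s))"
  have "cut_level A B T T = 1" using assms(1) by (simp add: cut_level_def)
  then have T: "slab_coord p < cut_level A B T T" using slab_coord_bounds(2)[of p] by simp
  have c0: "cut_level A B T 0 = 0" by (simp add: cut_level_def)
  have "T \<noteq> 0" using assms(1) by (cases T) auto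
  then have T': "slab_coord p < cut_level A B T (Suc (T - 1))" using T by simp
  have s: "slab_coord p < cut_level A B T (Suc s)"
    unfolding s_def by (rule LeastI[of "\<lambda>s. slab_coord p < cut_level A B T (Suc s)", OF T'])
  have "s \<le> T - 1" unfolding s_def by (rule Least_le[of "\<lambda>s. slab_coord p < cut_level A B T (Suc s)", OF T'])
  then have sT: "s < T" using \<open>T \<noteq> 0\<close> by simp
  have "\<not> slab_coord p < cut_level A B T s"
  proof (cases s)
    case 0
    then show ?thesis using c0 slab_coord_bounds(1)[of p] by simp
  next
    case (Suc r)
    then have "r < s" by simp
    then show ?thesis using not_less_Least[of r "\<lambda>s. slab_coord p < cut_level A B T (Suc s)"] Suc
      unfolding s_def[symmetric] by simp
  qed
  moreover have "slab_coord p \<noteq> cut_level A B T s"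
    using assms(2) sT by (auto simp: generic_def)
  ultimately show ?thesis using s sT by (intro exI[of _ s]) auto
qed

lemma signed_density_slab:
  assumes "s < T" "cut_level A B T s < slab_coord p" "slab_coord p < cut_level A B T (Suc s)"
  shows "signed_density A B T p = sgn (A s \<bullet> p + B s)"
proof -
  have "\<not> (cut_level A B T r < slab_coord p \<and> slab_coord p < cut_level A B T (Suc r))" if "r \<noteq> s" for r
    using that assms cut_level_mono[of "Suc r" s A B T] cut_level_mono[of "Suc s" r A B T]
    by (cases "r < s") auto
  then have "signed_density A B T p = (\<Sum>r<T. if r = s then sgn (A s \<bullet> p + B s) else 0)"
    unfolding signed_density_def using assms by (intro sum.cong) auto
  also have "\<dots> = sgn (A s \<bullet> p + B s)" using assms(1) by simp
  finally show ?thesis .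
qed

text \<open>A crude bound, sufficient for dominated convergence.\<close>

lemma abs_signed_density_le: "\<bar>signed_density A B T p\<bar> \<le> real T"
proof -
  have "\<bar>signed_density A B T p\<bar> \<le> (\<Sum>s<T. 1)"
    unfolding signed_density_def
    by (rule order_trans[OF sum_abs], rule sum_mono) (auto simp: sgn_if)
  then show ?thesis by simp
qed

lemma signed_density_measurable [measurable]: "signed_density A B T \<in> borel_measurable borel"
proof -
  have [measurable]: "(slab_coord :: 'a \<Rightarrow> real) \<in> borel_measurable borel"
    by (intro borel_measurable_continuous_onI continuous_intros)
  have sg: "(\<lambda>p. sgn (A s \<bullet> p + B s)) \<in> borel_measurable borel" for s
    unfolding sgn_if by measurable
  show ?thesis
    unfolding signed_density_def
    by (intro borel_measurable_sum measurable_If sg) measurable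
qed

section \<open>Realisation of the slabs by iterated cuts\<close>

lemma cut_partition_slabs:
  assumes "\<And>s. s < k \<Longrightarrow> u s \<le> u (Suc s)" "u 0 \<le> 0"
  shows "cut_partition (map (\<lambda>s. {p :: 'a::euclidean_space. u s \<le> slab_coord p \<and> slab_coord p \<le> u (Suc s)}) [0..<k]
    @ [{p. u k \<le> slab_coord p}])"
  using assms(1)
proof (induction k)
  case 0
  have "{p :: 'a. u 0 \<le> slab_coord p} = UNIV"
    using slab_coord_bounds(1) assms(2) by (auto intro: order_trans less_imp_le)
  then show ?case by (simp add: cut_partition.base)
next
  case (Suc k)
  let ?S = "\<lambda>s. {p :: 'a. u s \<le> slab_coord p \<and> slab_coord p \<le> u (Suc s)}"
  let ?P = "map ?S [0..<k] @ [{p. u k \<le> slab_coord p}]"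
  have "cut_partition (?P[k := ?P ! k \<inter> {p. slab_coord p \<le> u (Suc k)}] @ [?P ! k \<inter> {p. u (Suc k) \<le> slab_coord p}])"
    using Suc by (intro cut_partition.step halfspace_pair_slab_coord) auto
  moreover have "{p :: 'a. u k \<le> slab_coord p} \<inter> {p. slab_coord p \<le> u (Suc k)} = ?S k"
    "{p :: 'a. u k \<le> slab_coord p} \<inter> {p. u (Suc k) \<le> slab_coord p} = {p. u (Suc k) \<le> slab_coord p}"
    using Suc.prems[of k] by auto
  ultimately show ?case
    by (simp add: nth_append list_update_append)
qed

text \<open>\<open>step\<close> keeps one half in place and appends the other, so the second halves
  gather at the end in their order.\<close>

lemma cut_partition_refine:
  assumes "cut_partition P" "k \<le> length P" "\<And>s. s < k \<Longrightarrow> halfspace_pair (C s) (D s)"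
  shows "cut_partition (map (\<lambda>s. P ! s \<inter> C s) [0..<k] @ drop k P @ map (\<lambda>s. P ! s \<inter> D s) [0..<k])"
  using assms(2,3)
proof (induction k)
  case 0
  then show ?case using assms(1) by simp
next
  case (Suc k)
  let ?P = "map (\<lambda>s. P ! s \<inter> C s) [0..<k] @ drop k P @ map (\<lambda>s. P ! s \<inter> D s) [0..<k]"
  have dr: "drop k P = P ! k # drop (Suc k) P"
    using Suc.prems(1) by (simp add: Cons_nth_drop_Suc)
  have "cut_partition (?P[k := ?P ! k \<inter> C k] @ [?P ! k \<inter> D k])"
    using Suc by (intro cut_partition.step) auto
  moreover have "?P ! k = P ! k" by (simp add: nth_append dr)
  moreover have "?P[k := P ! k \<inter> C k] = map (\<lambda>s. P ! s \<inter> C s) [0..<Suc k] @ drop (Suc k) P @ map (\<lambda>s. P ! s \<inter> D s) [0..<k]"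
    by (simp add: list_update_append dr)
  ultimately show ?case by simp
qed

lemma cut_partition_closed_convex:
  "cut_partition P \<Longrightarrow> K \<in> set P \<Longrightarrow> closed K \<and> convex K"
proof (induction arbitrary: K rule: cut_partition.induct)
  case base
  then show ?case by simp
next
  case (step P i A B)
  have AB: "closed A" "convex A" "closed B" "convex B"
    using step.hyps(3) unfolding halfspace_pair_def
    by (auto simp: closed_halfspace_ge closed_halfspace_le convex_halfspace_ge convex_halfspace_le)
  have "P ! i \<in> set P" using step.hyps(2) by simp
  then have "closed (P ! i)" "convex (P ! i)" using step.IH by auto
  moreover have "K \<in> insert (P ! i \<inter> A) (set P) \<or> K = P ! i \<inter> B"
    using step.prems set_update_subset_insert[of P i "P ! i \<inter> A"] by auto
  ultimately show ?case
    using AB step.IH by (auto intro: closed_Int convex_Int)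
next
  case (reorder P Q)
  then show ?case by (metis mset_eq_setD)
qed


text \<open>Indices below \<open>k\<close> are the nonnegative halves, those from \<open>k\<close>
  to \<open>T - 1\<close> the uncut slabs, and those from \<open>T\<close> on the remaining halves.
  A zero function cuts by a degenerate pair, since its two sets would both be the whole
  space.\<close>

definition slab_part :: "(nat \<Rightarrow> 'a::euclidean_space) \<Rightarrow> (nat \<Rightarrow> real) \<Rightarrow> nat \<Rightarrow> nat \<Rightarrow> nat \<Rightarrow> 'a set" where
  "slab_part A B T k i = (let s = (if i < T then i else i - T) in
     {p. cut_level A B T s \<le> slab_coord p \<and> slab_coord p \<le> cut_level A B T (Suc s)} \<inter>
     (if i < k then (if weight A B s = 0 then UNIV else {p. 0 \<le> A s \<bullet> p + B s})
      else if i < T then UNIV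
      else (if weight A B s = 0 then {} else {p. A s \<bullet> p + B s \<le> 0})))"

lemma halfspace_pair_affine:
  "halfspace_pair (if norm a + \<bar>b\<bar> = 0 then UNIV else {p. 0 \<le> a \<bullet> p + b})
     (if norm a + \<bar>b\<bar> = 0 then {} else {p. a \<bullet> p + b \<le> 0})"
proof (cases "a = 0")
  case True
  then show ?thesis by (cases b "0::real" rule: linorder_cases) (auto simp: halfspace_pair_def)
next
  case False
  then have "norm a + \<bar>b\<bar> \<noteq> 0" by (simp add: add_nonneg_eq_0_iff)
  moreover have "{p. 0 \<le> a \<bullet> p + b} = {p. a \<bullet> p \<ge> - b}" "{p. a \<bullet> p + b \<le> 0} = {p. a \<bullet> p \<le> - b}"
    by auto
  ultimately show ?thesis using False unfolding halfspace_pair_def by auto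
qed

lemma cut_partition_slab_parts:
  assumes "0 < (\<Sum>r<T. weight A B r)" "k \<le> T"
  shows "cut_partition (map (slab_part A B T k) [0..<T + k])"
proof -
  let ?u = "cut_level A B T"
  let ?S = "\<lambda>s. {p. ?u s \<le> slab_coord p \<and> slab_coord p \<le> ?u (Suc s)}"
  have "T \<noteq> 0" using assms(1) by (cases T) auto
  then obtain T' where T': "T = Suc T'" by (cases T) auto
  have "?u T = 1" using assms(1) by (simp add: cut_level_def)
  \<comment> \<open>The top level is 1, which \<open>slab_coord\<close> never reaches, so the last
    slab needs no upper cut.\<close>
  then have last: "{p. ?u T' \<le> slab_coord p} = ?S T'"
    using slab_coord_bounds(2) by (auto simp: T' intro: less_imp_le)
  have "cut_partition (map ?S [0..<T'] @ [{p. ?u T' \<le> slab_coord p}])"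
  proof (rule cut_partition_slabs)
    show "?u s \<le> ?u (Suc s)" for s by (simp add: cut_level_mono)
    show "?u 0 \<le> 0" by (simp add: cut_level_def)
  qed
  then have P: "cut_partition (map ?S [0..<T])"
    unfolding last by (simp add: T')
  let ?C = "\<lambda>s. if weight A B s = 0 then UNIV else {p. 0 \<le> A s \<bullet> p + B s}"
  let ?D = "\<lambda>s. if weight A B s = 0 then {} else {p. A s \<bullet> p + B s \<le> 0}"
  have "cut_partition (map (\<lambda>s. map ?S [0..<T] ! s \<inter> ?C s) [0..<k] @ drop k (map ?S [0..<T])
      @ map (\<lambda>s. map ?S [0..<T] ! s \<inter> ?D s) [0..<k])"
    using assms(2) halfspace_pair_affine[of "A s" "B s" for s]
    by (intro cut_partition_refine[OF P]) (auto simp: weight_def)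
  also have "map (\<lambda>s. map ?S [0..<T] ! s \<inter> ?C s) [0..<k] @ drop k (map ?S [0..<T])
      @ map (\<lambda>s. map ?S [0..<T] ! s \<inter> ?D s) [0..<k] = map (slab_part A B T k) [0..<T + k]"
    using assms(2) by (intro nth_equalityI) (auto simp: nth_append slab_part_def Let_def)
  finally show ?thesis .
qed

lemma slab_part_generic:
  assumes "0 < (\<Sum>r<T. weight A B r)" "k \<le> T" "generic A B T p" "i < T + k"
    and s: "s < T" "cut_level A B T s < slab_coord p" "slab_coord p < cut_level A B T (Suc s)"
  shows "p \<in> slab_part A B T k i \<longleftrightarrow> (if i < k then i = s \<and> 0 < A s \<bullet> p + B s
     else if i < T then i = s else i - T = s \<and> A s \<bullet> p + B s < 0)"
proof -
  have uniq: "r = s" if "cut_level A B T r \<le> slab_coord p" "slab_coord p \<le> cut_level A B T (Suc r)" for r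
    using that s cut_level_mono[of "Suc r" s A B T] cut_level_mono[of "Suc s" r A B T]
    by (cases r s rule: linorder_cases) auto
  have w: "0 < weight A B s" using weight_pos_if_level_less[of A B T s] s by auto
  then have g: "A s \<bullet> p + B s \<noteq> 0" using assms(3) s(1) by (auto simp: generic_def)
  show ?thesis
    using uniq s w g assms(2,4) by (auto simp: slab_part_def Let_def dest: uniq split: if_splits)
qed

text \<open>An uncut slab carries a constant function, whose sign serves as its label.\<close>

definition slab_label :: "(nat \<Rightarrow> real) \<Rightarrow> nat \<Rightarrow> nat \<Rightarrow> nat \<Rightarrow> nat" where
  "slab_label B T k i = (if i < k then 0 else if i < T then (if 0 \<le> B i then 0 else 1) else 1)"

text \<open>A generic point lies inside one slab, and there only in the part selected by the sign of
  the function.\<close>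

lemma slab_union_generic:
  assumes "0 < (\<Sum>r<T. weight A B r)" "k \<le> T" "generic A B T p"
    and A0: "\<And>s. k \<le> s \<Longrightarrow> s < T \<Longrightarrow> A s = 0"
  shows "signed_density A B T p = 1 \<and> p \<in> (\<Union>i\<in>{i. i < T + k \<and> slab_label B T k i = 0}. slab_part A B T k i)
      \<and> p \<notin> (\<Union>i\<in>{i. i < T + k \<and> slab_label B T k i = 1}. slab_part A B T k i) \<or>
    signed_density A B T p = -1 \<and> p \<notin> (\<Union>i\<in>{i. i < T + k \<and> slab_label B T k i = 0}. slab_part A B T k i)
      \<and> p \<in> (\<Union>i\<in>{i. i < T + k \<and> slab_label B T k i = 1}. slab_part A B T k i)"
proof -
  obtain s where s: "s < T" "cut_level A B T s < slab_coord p" "slab_coord p < cut_level A B T (Suc s)"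
    using exists_slab[OF assms(1,3)] by blast
  note mem = slab_part_generic[OF assms(1-3) _ s]
  have d: "signed_density A B T p = sgn (A s \<bullet> p + B s)"
    using signed_density_slab[OF s] .
  have w: "0 < weight A B s" using weight_pos_if_level_less[of A B T s] s by auto
  then have g: "A s \<bullet> p + B s \<noteq> 0" using assms(3) s(1) by (auto simp: generic_def)
  show ?thesis
  proof (cases "s < k")
    case True
    have m: "p \<in> slab_part A B T k i \<longleftrightarrow> i = s \<and> 0 < A s \<bullet> p + B s \<or> i = T + s \<and> A s \<bullet> p + B s < 0"
      if "i < T + k" for i
      unfolding mem[OF that] using True assms(2) by auto
    have "s < T + k" "T + s < T + k" "slab_label B T k s = 0" "slab_label B T k (T + s) = 1"
      using True assms(2) by (auto simp: slab_label_def)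
    then show ?thesis
      using g d m by (cases "0 < A s \<bullet> p + B s") auto
  next
    case False
    then have B: "A s \<bullet> p + B s = B s" using A0 s by simp
    have m: "p \<in> slab_part A B T k i \<longleftrightarrow> i = s" if "i < T + k" for i
      unfolding mem[OF that] using False s that by auto
    have "s < T + k" "slab_label B T k s = (if 0 \<le> B s then 0 else 1)"
      using False s by (auto simp: slab_label_def)
    then show ?thesis
      using g d m B by (cases "0 < B s") auto
  qed
qed

text \<open>Almost everywhere the density is the difference of the indicators of the two classes,
  and their sum is 1. A zero integral therefore gives equal measures with sum 1.\<close>

lemma measure_slab_unions:
  fixes A :: "nat \<Rightarrow> 'a::euclidean_space"
  assumes mu: "ac_prob_measure \<mu>"
    and "0 < (\<Sum>r<T. weight A B r)" "k \<le> T" "\<And>s. k \<le> s \<Longrightarrow> s < T \<Longrightarrow> A s = 0"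
    and zero: "integral\<^sup>L \<mu> (signed_density A B T) = 0"
    and l: "l < 2"
  shows "measure \<mu> (\<Union>i\<in>{i. i < T + k \<and> slab_label B T k i = l}. slab_part A B T k i) = 1 / 2"
proof -
  interpret prob_space \<mu> using mu by (simp add: ac_prob_measure_def)
  have sets: "sets \<mu> = sets borel" using mu by (simp add: ac_prob_measure_def)
  define U where "U l = (\<Union>i\<in>{i. i < T + k \<and> slab_label B T k i = l}. slab_part A B T k i)" for l
  have "slab_part A B T k i \<in> sets borel" if "i < T + k" for i
    using cut_partition_closed_convex[OF cut_partition_slab_parts[OF assms(2,3)], of "slab_part A B T k i"] that
    by (auto intro: borel_closed)
  then have U[measurable]: "U l \<in> sets \<mu>" for l
    unfolding sets U_def by (intro sets.finite_UN) auto
  have AEU: "AE p in \<mu>. signed_density A B T p = indicator (U 0) p - indicator (U 1) p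
      \<and> indicator (U 0) p + indicator (U 1) p = (1::real)"
    using AE_generic[OF mu, of A B T]
  proof eventually_elim
    case (elim p)
    from slab_union_generic[OF assms(2,3) elim assms(4)] show ?case
      unfolding U_def[symmetric] by auto
  qed
  have int: "integrable \<mu> (indicator (U l) :: 'a \<Rightarrow> real)" for l
    by (rule integrable_real_indicator) (auto simp: less_top[symmetric])
  have ind: "integral\<^sup>L \<mu> (indicator (U l)) = measure \<mu> (U l)" for l
    using U[of l] by (simp add: sets.Int_space_eq2)
  have meas: "signed_density A B T \<in> borel_measurable \<mu>"
    using signed_density_measurable measurable_cong_sets[OF sets refl] by blast
  have "integral\<^sup>L \<mu> (signed_density A B T) = (LINT p|\<mu>. indicator (U 0) p - indicator (U 1) p)"
    by (rule integral_cong_AE) (use AEU meas in auto)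
  also have "\<dots> = measure \<mu> (U 0) - measure \<mu> (U 1)"
    by (subst Bochner_Integration.integral_diff[OF int int]) (simp only: ind)
  finally have 1: "measure \<mu> (U 0) = measure \<mu> (U 1)" using zero by simp
  have "(LINT p|\<mu>. indicator (U 0) p + indicator (U 1) p) = (LINT p|\<mu>. 1 :: real)"
    by (rule integral_cong_AE) (use AEU in auto)
  then have "measure \<mu> (U 0) + measure \<mu> (U 1) = 1"
    by (subst (asm) Bochner_Integration.integral_add[OF int int]) (simp add: ind prob_space)
  with 1 l have "measure \<mu> (U l) = 1 / 2"
    by (cases "l = 0") (auto simp: numeral_2_eq_2 less_Suc_eq)
  then show ?thesis by (simp add: U_def)
qed

text \<open>Borsuk-Ulam applied to the \<open>N\<close> integrals of the density as functions of the
  coefficients. They are odd since the density is, and continuous by dominated convergence; a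
  nonzero coefficient keeps the total weight positive.\<close>

lemma equipartitionable_slabs:
  fixes A :: "(nat \<Rightarrow> real) \<Rightarrow> nat \<Rightarrow> 'a::euclidean_space"
    and B :: "(nat \<Rightarrow> real) \<Rightarrow> nat \<Rightarrow> real"
  assumes "k \<le> T"
    and A0: "\<And>z s. k \<le> s \<Longrightarrow> s < T \<Longrightarrow> A z s = 0"
    and odd: "\<And>z s. A (\<lambda>b. - z b) s = - A z s" "\<And>z s. B (\<lambda>b. - z b) s = - B z s"
    and cont: "\<And>x z s. (\<And>b. (\<lambda>n. x n b) \<longlonglongrightarrow> z b) \<Longrightarrow> (\<lambda>n. A (x n) s) \<longlonglongrightarrow> A z s"
      "\<And>x z s. (\<And>b. (\<lambda>n. x n b) \<longlonglongrightarrow> z b) \<Longrightarrow> (\<lambda>n. B (x n) s) \<longlonglongrightarrow> B z s"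
    and nz: "\<And>z. z \<in> cube_boundary N \<Longrightarrow> \<exists>s<T. A z s \<noteq> 0 \<or> B z s \<noteq> 0"
  shows "equipartitionable (T + k) 2 TYPE('a) N"
  unfolding equipartitionable_def
proof (intro allI impI)
  fix \<mu> :: "nat \<Rightarrow> 'a measure" assume mu: "\<forall>j<N. ac_prob_measure (\<mu> j)"
  have pos: "0 < (\<Sum>r<T. weight (A z) (B z) r)" if z: "z \<in> cube_boundary N" for z
  proof -
    obtain s where s: "s < T" "A z s \<noteq> 0 \<or> B z s \<noteq> 0" using nz[OF z] by blast
    have "0 < weight (A z) (B z) s" using s(2) by (auto simp: weight_def add_pos_nonneg add_nonneg_pos)
    then show ?thesis using s(1) by (intro sum_pos2[of _ s]) (auto intro: weight_nonneg)
  qed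
  let ?F = "\<lambda>z j. integral\<^sup>L (\<mu> j) (signed_density (A z) (B z) T)"
  have "\<exists>z\<in>cube_boundary N. \<forall>j<N. ?F z j = 0"
  proof (rule borsuk_ulam_cube)
    fix z j
    have "A (\<lambda>b. - z b) = (\<lambda>s. - A z s)" "B (\<lambda>b. - z b) = (\<lambda>s. - B z s)"
      using odd by auto
    then have "signed_density (A (\<lambda>b. - z b)) (B (\<lambda>b. - z b)) T = (\<lambda>p. - signed_density (A z) (B z) T p)"
      using signed_density_uminus[of "A z" "B z" T] by presburger
    then show "?F (\<lambda>b. - z b) j = - ?F z j" by simp
  next
    fix x z j assume j: "j < N" and z: "z \<in> cube_boundary N" and lim: "\<And>b. (\<lambda>n. x n b) \<longlonglongrightarrow> z b"
    have muj: "ac_prob_measure (\<mu> j)" using mu j by blast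
    interpret prob_space "\<mu> j" using muj by (simp add: ac_prob_measure_def)
    have sets: "sets (\<mu> j) = sets borel" using muj by (simp add: ac_prob_measure_def)
    have meas: "signed_density A' B' T \<in> borel_measurable (\<mu> j)" for A' :: "nat \<Rightarrow> 'a" and B'
      using signed_density_measurable measurable_cong_sets[OF sets refl] by blast
    show "(\<lambda>n. ?F (x n) j) \<longlonglongrightarrow> ?F z j"
    proof (rule integral_dominated_convergence[where w = "\<lambda>_. real T"])
      show "AE p in \<mu> j. (\<lambda>n. signed_density (A (x n)) (B (x n)) T p) \<longlonglongrightarrow> signed_density (A z) (B z) T p"
        using AE_generic[OF muj, of "A z" "B z" T]
        by eventually_elim (rule tendsto_signed_density[OF cont(1)[OF lim] cont(2)[OF lim] pos[OF z]])
      show "AE p in \<mu> j. norm (signed_density (A (x n)) (B (x n)) T p) \<le> real T" for n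
        using abs_signed_density_le[of "A (x n)" "B (x n)" T] by simp
    qed (use meas in simp_all)
  qed
  then obtain z where z: "z \<in> cube_boundary N" "\<forall>j<N. ?F z j = 0" by blast
  let ?K = "map (slab_part (A z) (B z) T k) [0..<T + k]"
  have "(\<Union>i\<in>{i. i < T + k \<and> slab_label (B z) T k i = s}. ?K ! i)
      = (\<Union>i\<in>{i. i < T + k \<and> slab_label (B z) T k i = s}. slab_part (A z) (B z) T k i)" for s
    by auto
  then have "\<forall>j<N. \<forall>s<2. measure (\<mu> j) (\<Union>i\<in>{i. i < T + k \<and> slab_label (B z) T k i = s}. ?K ! i) = 1 / real 2"
    using measure_slab_unions[OF _ pos[OF z(1)] assms(1) A0] z(2) mu by simp
  moreover have "\<forall>i<T + k. slab_label (B z) T k i < 2"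
    by (simp add: slab_label_def)
  moreover have "length ?K = T + k" by simp
  ultimately show "\<exists>K lab. cut_partition K \<and> length K = T + k \<and> (\<forall>i<T + k. lab i < (2::nat)) \<and>
      (\<forall>j<N. \<forall>s<2. measure (\<mu> j) (\<Union>i\<in>{i. i < T + k \<and> lab i = s}. K ! i) = 1 / real 2)"
    using cut_partition_slab_parts[OF pos[OF z(1)] assms(1)] by blast
qed

text \<open>A cut slab has \<open>DIM('a) + 1\<close> coefficients, an uncut one has a single one.
  The number of measures is the total number of coefficients minus 1, the dimension of the boundary
  of the cube.\<close>

lemma equipartitionable_slabs_ge:
  assumes "T = t \<and> 0 < t \<and> N = t * (DIM('a::euclidean_space) + 1) - 1 \<or> T = Suc t \<and> N = t * (DIM('a) + 1)"
  shows "equipartitionable (T + t) 2 TYPE('a) N"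
proof -
  let ?d = "DIM('a)"
  obtain e :: "nat \<Rightarrow> 'a" where e: "bij_betw e {..<?d} Basis"
    using ex_bij_betw_nat_finite[OF finite_Basis] unfolding atLeast0LessThan by blast
  \<comment> \<open>Consecutive blocks of \<open>?d + 1\<close> coordinates of \<open>z\<close> hold
    the coefficients of the cut slabs, with the constant last in each block.\<close>
  define A where "A z s = (if s < t then \<Sum>c<?d. z (s * (?d + 1) + c) *\<^sub>R e c else 0)" for z :: "nat \<Rightarrow> real" and s
  define B where "B z s = (if s < t then z (s * (?d + 1) + ?d) else z (t * (?d + 1)))" for z :: "nat \<Rightarrow> real" and s
  have Ae: "A z s \<bullet> e c = z (s * (?d + 1) + c)" if "s < t" "c < ?d" for z s c
  proof -
    have "e c' \<bullet> e c = (if c' = c then 1 else 0)" if "c' < ?d" for c'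
    proof -
      have "e c' \<in> Basis" "e c \<in> Basis" "e c' = e c \<longleftrightarrow> c' = c"
        using e that \<open>c < ?d\<close> by (auto simp: bij_betw_def inj_on_def)
      then show ?thesis by (simp add: inner_Basis)
    qed
    then have "(\<Sum>c'<?d. z (s * (?d + 1) + c') * (e c' \<bullet> e c))
        = (\<Sum>c'<?d. if c' = c then z (s * (?d + 1) + c) else 0)"
      by (intro sum.cong) auto
    then show ?thesis using that by (simp add: A_def inner_sum_left)
  qed
  show ?thesis
  proof (rule equipartitionable_slabs[where A = A and B = B])
    fix z assume "z \<in> cube_boundary N"
    then obtain b where b: "b \<le> N" "z b \<noteq> 0" by (auto simp: cube_boundary_def)
    \<comment> \<open>A nonzero coordinate is located by its slab \<open>s\<close> and its place
      \<open>c\<close> in the block.\<close>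
    define s c where "s = b div (?d + 1)" and "c = b mod (?d + 1)"
    have bsc: "b = s * (?d + 1) + c" "c < ?d + 1"
      unfolding s_def c_def by (simp_all only: div_mult_mod_eq) simp
    show "\<exists>s<T. A z s \<noteq> 0 \<or> B z s \<noteq> 0"
    proof (cases "s < t")
      case True
      have "A z s \<noteq> 0 \<or> B z s \<noteq> 0"
      proof (cases "c < ?d")
        case c: True
        then have "A z s \<bullet> e c \<noteq> 0" using Ae[OF True c] b bsc by simp
        then show ?thesis by auto
      next
        case False
        then have "c = ?d" using bsc(2) by simp
        then show ?thesis using True b bsc by (simp add: B_def)
      qed
      then show ?thesis using True assms by (intro exI[of _ s]) auto
    next
      case False
      \<comment> \<open>Indices up to \<open>N\<close> beyond the blocks exist only in the second
        case, where there is just one.\<close>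
      then have ge: "t * (?d + 1) \<le> b"
        using bsc(1) by (metis add.commute linorder_not_le mult_le_mono1 trans_le_add2)
      from assms show ?thesis
      proof
        assume a: "T = t \<and> 0 < t \<and> N = t * (?d + 1) - 1"
        then have "0 < t * (?d + 1)" by simp
        then have "N < t * (?d + 1)" using a by linarith
        then show ?thesis using ge b(1) by linarith
      next
        assume a: "T = Suc t \<and> N = t * (?d + 1)"
        then have "b = t * (?d + 1)" using ge b(1) by linarith
        then show ?thesis using a b(2) by (intro exI[of _ t]) (simp add: B_def)
      qed
    qed
  next
    show "t \<le> T" using assms by auto
    show "A z s = 0" if "t \<le> s" for z s using that by (simp add: A_def)
    show "A (\<lambda>b. - z b) s = - A z s" "B (\<lambda>b. - z b) s = - B z s" for z s
      by (simp_all add: A_def B_def sum_negf)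
    show "(\<lambda>n. A (x n) s) \<longlonglongrightarrow> A z s" "(\<lambda>n. B (x n) s) \<longlonglongrightarrow> B z s"
      if "\<And>b. (\<lambda>n. x n b) \<longlonglongrightarrow> z b" for x z s
      using that by (auto simp: A_def B_def intro!: tendsto_intros)
  qed
qed

subsection \<open>Upper bounds\<close>

lemma Mpp_le:
  assumes "\<And>m. equipartitionable n r T m \<Longrightarrow> m \<le> M"
  shows "Mpp n r T \<le> enat M"
  unfolding Mpp_def
proof (rule Sup_least)
  fix x assume "x \<in> {enat m |m. equipartitionable n r T m}"
  then obtain m where "x = enat m" "equipartitionable n r T m" by blast
  then show "x \<le> enat M" using assms by simp
qed

lemma le_Mpp: "equipartitionable n r T m \<Longrightarrow> enat m \<le> Mpp n r T"
  unfolding Mpp_def by (rule Sup_upper) blast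

section \<open>Uniform measures on balls as test measures\<close>

lemma ball_lborel:
  fixes c :: "'a::euclidean_space"
  assumes "0 < r"
  shows "emeasure lborel (ball c r) \<noteq> 0" "emeasure lborel (ball c r) \<noteq> \<infinity>"
proof -
  show "emeasure lborel (ball c r) \<noteq> 0"
    using assms less_imp_neq[OF unit_ball_vol_pos[of "real DIM('a)"]] by (simp add: emeasure_ball)
  show "emeasure lborel (ball c r) \<noteq> \<infinity>"
    using emeasure_lborel_ball_finite[of c r] by simp
qed

lemma ac_prob_uniform_ball:
  fixes c :: "'a::euclidean_space"
  assumes "0 < r"
  shows "ac_prob_measure (uniform_measure lborel (ball c r))"
proof -
  have "absolutely_continuous lborel (uniform_measure lborel (ball c r))"
    unfolding absolutely_continuous_def
  proof
    fix X assume X: "X \<in> null_sets (lborel :: 'a measure)"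
    then have "ball c r \<inter> X \<in> null_sets lborel" by (intro null_set_Int1) auto
    then show "X \<in> null_sets (uniform_measure lborel (ball c r))"
      using X emeasure_uniform_measure[of "ball c r" lborel X] by (intro null_setsI) (auto simp: null_sets_def)
  qed
  then show ?thesis
    using prob_space_uniform_measure[OF ball_lborel[OF assms]] by (simp add: ac_prob_measure_def)
qed

lemma uniform_ball_half:
  fixes c :: "'a::euclidean_space"
  assumes "0 < r" "S \<in> sets borel" "measure (uniform_measure lborel (ball c r)) S = 1 / 2"
  shows "S \<inter> ball c r \<noteq> {}" "\<not> ball c r \<subseteq> S"
proof -
  have m: "measure (uniform_measure lborel (ball c r)) S = measure lborel (ball c r \<inter> S) / measure lborel (ball c r)"
    by (rule measure_uniform_measure) (use ball_lborel[OF assms(1)] assms(2) in auto)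
  show "S \<inter> ball c r \<noteq> {}"
    using m assms(3) by (auto simp: Int_commute)
  have "measure lborel (ball c r) \<noteq> 0"
    using ball_lborel[OF assms(1), of c] by (simp add: measure_def enn2real_eq_0_iff)
  then show "\<not> ball c r \<subseteq> S"
    using m assms(3) by (auto simp: Int_absorb2)
qed

definition label_union :: "'a set list \<Rightarrow> (nat \<Rightarrow> nat) \<Rightarrow> nat \<Rightarrow> 'a set" where
  "label_union K lab s = (\<Union>i\<in>{i. i < length K \<and> lab i = s}. K ! i)"

lemma label_union_borel:
  assumes "cut_partition K"
  shows "label_union K lab s \<in> sets borel"
  unfolding label_union_def
proof (intro sets.finite_UN)
  fix i assume "i \<in> {i. i < length K \<and> lab i = s}"
  then have "K ! i \<in> set K" by simp
  then show "K ! i \<in> sets borel"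
    using cut_partition_closed_convex[OF assms] by (intro borel_closed) simp
qed simp

lemma equipartitionable_balls:
  fixes c :: "nat \<Rightarrow> 'a::euclidean_space"
  assumes "equipartitionable n 2 TYPE('a) m" "0 < r"
  shows "\<exists>K lab. cut_partition K \<and> length K = n \<and> (\<forall>i<n. lab i < 2) \<and>
    (\<forall>j<m. \<forall>s<2. measure (uniform_measure lborel (ball (c j) r)) (label_union K lab s) = 1 / 2)"
proof -
  have "\<exists>K lab. cut_partition K \<and> length K = n \<and> (\<forall>i<n. lab i < (2::nat)) \<and>
    (\<forall>j<m. \<forall>s<2. measure (uniform_measure lborel (ball (c j) r)) (\<Union>i\<in>{i. i < n \<and> lab i = s}. K ! i) = 1 / real 2)"
    using assms(1)[unfolded equipartitionable_def, rule_format, of "\<lambda>j. uniform_measure lborel (ball (c j) r)"]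
      ac_prob_uniform_ball[OF assms(2)] by blast
  then obtain K lab where K: "cut_partition K" "length K = n" "\<forall>i<n. lab i < (2::nat)"
    "\<forall>j<m. \<forall>s<2. measure (uniform_measure lborel (ball (c j) r)) (\<Union>i\<in>{i. i < n \<and> lab i = s}. K ! i) = 1 / real 2"
    by blast
  then show ?thesis
    by (intro exI[of _ K] exI[of _ lab]) (simp add: label_union_def)
qed

section \<open>Two and three parts in any dimension\<close>

lemma norm_less_if_small_coords:
  fixes a :: "'a::euclidean_space"
  assumes "a \<noteq> 0" "\<And>e. e \<in> Basis \<Longrightarrow> \<bar>a \<bullet> e\<bar> \<le> q * norm a" "q * real DIM('a) < 1"
  shows False
proof -
  have "norm a \<le> (\<Sum>e\<in>Basis. \<bar>a \<bullet> e\<bar>)" by (rule norm_le_l1)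
  also have "\<dots> \<le> (\<Sum>e\<in>(Basis :: 'a set). q * norm a)" by (rule sum_mono) (rule assms(2))
  also have "\<dots> = (q * real DIM('a)) * norm a" by simp
  also have "\<dots> < 1 * norm a" using assms(1,3) by (intro mult_strict_right_mono) auto
  finally show False by simp
qed

lemma inner_ball:
  fixes a :: "'a::euclidean_space"
  assumes "x \<in> ball c r"
  shows "\<bar>a \<bullet> x - a \<bullet> c\<bar> \<le> r * norm a"
proof -
  have "\<bar>a \<bullet> x - a \<bullet> c\<bar> = \<bar>a \<bullet> (x - c)\<bar>" by (simp add: inner_diff_right)
  also have "\<dots> \<le> norm a * norm (x - c)" by (rule Cauchy_Schwarz_ineq2)
  also have "\<dots> \<le> norm a * r" using assms by (intro mult_left_mono) (auto simp: dist_norm norm_minus_commute)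
  finally show ?thesis by (simp add: mult.commute)
qed

text \<open>Otherwise a hyperplane with normal \<open>a\<close> separates a point of the inner ball
  from \<open>C\<close>, so \<open>a\<close> is at least \<open>- (2 * r * norm a)\<close> on each
  centre. The centres sum to 0, so these lower bounds give upper bounds as well. Hence all
  coordinates of \<open>a\<close> are too small for its norm.\<close>

lemma ball_subset_convex_hitting_simplex:
  fixes C :: "'a::euclidean_space set"
  assumes "closed C" "convex C" "2 * r * (real DIM('a))\<^sup>2 < 1" "0 < r"
    and hit: "\<And>e. e \<in> Basis \<Longrightarrow> C \<inter> ball e r \<noteq> {}" "C \<inter> ball (- \<Sum>Basis) r \<noteq> {}"
  shows "ball 0 r \<subseteq> C"
proof (rule ccontr)
  assume "\<not> ball 0 r \<subseteq> C"
  then obtain y where y: "y \<in> ball 0 r" "y \<notin> C" by blast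
  obtain a b where ab: "a \<bullet> y < b" "\<forall>x\<in>C. b < a \<bullet> x"
    using separating_hyperplane_closed_point[OF assms(2,1) y(2)] by blast
  have a0: "a \<noteq> 0" using ab hit(2) by auto
  have lower: "- (2 * r * norm a) \<le> a \<bullet> c" if "C \<inter> ball c r \<noteq> {}" for c
  proof -
    obtain x where x: "x \<in> C" "x \<in> ball c r" using \<open>C \<inter> ball c r \<noteq> {}\<close> by blast
    have "a \<bullet> y < a \<bullet> x" using ab x(1) by auto
    then show ?thesis using inner_ball[OF x(2), of a] inner_ball[OF y(1), of a] by auto
  qed
  have up: "a \<bullet> e \<le> 2 * r * real DIM('a) * norm a" if e: "e \<in> Basis" for e
  proof -
    have "- (2 * r * norm a) \<le> a \<bullet> (- \<Sum>Basis)" by (rule lower[OF hit(2)])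
    also have "\<dots> = - (a \<bullet> e) - (\<Sum>b\<in>Basis - {e}. a \<bullet> b)"
      using sum.remove[OF finite_Basis e, of "\<lambda>b. a \<bullet> b"] by (simp add: inner_sum_right)
    finally have "a \<bullet> e \<le> 2 * r * norm a - (\<Sum>b\<in>Basis - {e}. a \<bullet> b)" by simp
    also have "\<dots> \<le> 2 * r * norm a + (\<Sum>b\<in>Basis - {e}. 2 * r * norm a)"
    proof -
      have "(\<Sum>b\<in>Basis - {e}. - (2 * r * norm a)) \<le> (\<Sum>b\<in>Basis - {e}. a \<bullet> b)"
        by (rule sum_mono) (use lower[OF hit(1)] in auto)
      then show ?thesis by (simp add: sum_negf)
    qed
    also have "\<dots> = 2 * r * real DIM('a) * norm a"
      using e by (simp add: card_Diff_singleton of_nat_diff Suc_le_eq DIM_positive algebra_simps)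
    finally show ?thesis .
  qed
  have "1 \<le> real DIM('a)" using DIM_positive[where 'a = 'a] by (simp add: Suc_le_eq)
  then have "2 * r * norm a * 1 \<le> 2 * r * norm a * real DIM('a)"
    using assms(4) by (intro mult_left_mono) auto
  then have "\<bar>a \<bullet> e\<bar> \<le> 2 * r * real DIM('a) * norm a" if "e \<in> Basis" for e
    using up[OF that] lower[OF hit(1)[OF that]] by (simp add: abs_le_iff algebra_simps)
  then show False
    using norm_less_if_small_coords[OF a0, of "2 * r * real DIM('a)"] assms(3)
    by (simp add: power2_eq_square)
qed

text \<open>One of two labels is used for at most one of three parts, so its class is convex. It
  meets the balls around the vertices of a simplex and thus contains the ball around 0, of which it
  should have only half.\<close>

lemma equipartitionable_three_le:
  assumes "equipartitionable 3 2 TYPE('a::euclidean_space) m"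
  shows "m \<le> DIM('a) + 1"
proof (rule ccontr)
  assume "\<not> m \<le> DIM('a) + 1"
  then have m: "DIM('a) + 1 < m" by simp
  let ?d = "DIM('a)"
  have d: "1 \<le> real ?d" using DIM_positive[where 'a = 'a] by (simp add: Suc_le_eq)
  \<comment> \<open>With this radius the quantity required to be below 1 equals 1/2.\<close>
  define r where "r = 1 / (4 * (real ?d)\<^sup>2)"
  have r: "0 < r" "2 * r * (real ?d)\<^sup>2 < 1" using d by (auto simp: r_def)
  obtain e :: "nat \<Rightarrow> 'a" where e: "bij_betw e {..<?d} Basis"
    using ex_bij_betw_nat_finite[OF finite_Basis] unfolding atLeast0LessThan by blast
  \<comment> \<open>The first \<open>?d + 1\<close> centres sum to 0; the next index gives the inner
    ball.\<close>
  define c where "c j = (if j < ?d then e j else if j = ?d then - \<Sum>Basis else 0)" for j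
  obtain K lab where K: "cut_partition K" "length K = 3" "\<forall>i<3. lab i < 2"
    "\<forall>j<m. \<forall>s<2. measure (uniform_measure lborel (ball (c j) r)) (label_union K lab s) = 1 / 2"
    using equipartitionable_balls[OF assms r(1), of c] by blast
  have part: "closed (K ! i) \<and> convex (K ! i)" if "i < 3" for i
    using cut_partition_closed_convex[OF K(1)] that K(2) by simp
  have "\<exists>s<2. \<exists>i<3. {i. i < 3 \<and> lab i = s} \<subseteq> {i}"
  proof -
    have l3: "i < 3 \<longleftrightarrow> i = 0 \<or> i = 1 \<or> i = 2" for i :: nat by auto
    have l: "lab 0 < 2" "lab 1 < 2" "lab 2 < 2" using K(3) by auto
    have other: "1 - lab i \<noteq> lab i" for i by arith
    \<comment> \<open>Two of the three labels agree, so the opposite label occurs at most at the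
      third part.\<close>
    consider "lab 0 = lab 1" | "lab 0 = lab 2" | "lab 1 = lab 2" using l by linarith
    then show ?thesis
    proof cases
      case 1
      show ?thesis by (rule exI[of _ "1 - lab 0"]) (use 1 l other[of 0] other[of 1] in \<open>auto simp: l3 intro!: exI[of _ 2]\<close>)
    next
      case 2
      show ?thesis by (rule exI[of _ "1 - lab 0"]) (use 2 l other[of 0] other[of 1] in \<open>auto simp: l3 intro!: exI[of _ 1]\<close>)
    next
      case 3
      show ?thesis by (rule exI[of _ "1 - lab 1"]) (use 3 l other[of 0] other[of 1] in \<open>auto simp: l3 intro!: exI[of _ 0]\<close>)
    qed
  qed
  then obtain s i where s: "s < 2" "i < 3" "{i. i < 3 \<and> lab i = s} \<subseteq> {i}" by blast
  from s(3) have "{i. i < 3 \<and> lab i = s} = {} \<or> {i. i < 3 \<and> lab i = s} = {i}"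
    by (rule subset_singletonD)
  then have "label_union K lab s = {} \<or> label_union K lab s = K ! i"
    unfolding label_union_def K(2) by fastforce
  then have C: "closed (label_union K lab s)" "convex (label_union K lab s)"
    using part[OF s(2)] by auto
  have half: "measure (uniform_measure lborel (ball (c j) r)) (label_union K lab s) = 1 / 2" if "j < m" for j
    using K(4) s(1) that by blast
  note hit = uniform_ball_half[OF r(1) label_union_borel[OF K(1)] half]
  have "ball 0 r \<subseteq> label_union K lab s"
  proof (rule ball_subset_convex_hitting_simplex[OF C r(2,1)])
    show "label_union K lab s \<inter> ball b r \<noteq> {}" if "b \<in> Basis" for b
    proof -
      obtain j where "j < ?d" "b = e j" using \<open>b \<in> Basis\<close> e by (auto simp: bij_betw_def)
      then show ?thesis using hit(1)[of j] m by (simp add: c_def)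
    qed
    show "label_union K lab s \<inter> ball (- \<Sum>Basis) r \<noteq> {}"
      using hit(1)[of ?d] m by (simp add: c_def)
  qed
  then show False using hit(2)[of "?d + 1"] m by (simp add: c_def)
qed

text \<open>Cuts only increase the number of parts, so two parts come from one cut of the whole
  space. The multiset absorbs \<open>reorder\<close>, and the case of one part identifies the set
  that was cut.\<close>

lemma cut_partition_two:
  "cut_partition P \<Longrightarrow> P \<noteq> [] \<and> (length P = 1 \<longrightarrow> P = [UNIV]) \<and>
     (length P = 2 \<longrightarrow> (\<exists>A B. halfspace_pair A B \<and> mset P = {#A, B#}))"
proof (induction rule: cut_partition.induct)
  case base
  then show ?case by simp
next
  case (step P i A B)
  have "0 < length P" using step.IH by simp
  moreover have "P[i := P ! i \<inter> A] @ [P ! i \<inter> B] = [A, B]" if "length P = 1"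
    using step.IH step.hyps(2) that by simp
  ultimately show ?case using step.hyps(3) by auto
next
  case (reorder P Q)
  then have len: "length Q = length P" by (metis size_mset)
  have "Q = [UNIV]" if "length Q = 1"
    using reorder that len by simp
  moreover have "Q \<noteq> []" using reorder.IH len by (metis length_0_conv)
  ultimately show ?case
    unfolding reorder.hyps(2) len using reorder.IH by blast
qed

text \<open>Both half-spaces meet every ball, so the hyperplane passes near 0 and near all basis
  vectors. Then all coordinates of the normal vector are too small for its norm.\<close>

lemma equipartitionable_two_le:
  assumes "equipartitionable 2 2 TYPE('a::euclidean_space) m"
  shows "m \<le> DIM('a)"
proof (rule ccontr)
  assume "\<not> m \<le> DIM('a)"
  then have m: "DIM('a) < m" by simp
  let ?d = "DIM('a)"
  have d: "1 \<le> real ?d" using DIM_positive[where 'a = 'a] by (simp add: Suc_le_eq)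
  define r where "r = 1 / (4 * real ?d)"
  have r: "0 < r" "2 * r * real ?d < 1" using d by (auto simp: r_def)
  obtain e :: "nat \<Rightarrow> 'a" where e: "bij_betw e {..<?d} Basis"
    using ex_bij_betw_nat_finite[OF finite_Basis] unfolding atLeast0LessThan by blast
  define c where "c j = (if j < ?d then e j else 0)" for j
  obtain K lab where K: "cut_partition K" "length K = 2" "\<forall>i<2. lab i < 2"
    "\<forall>j<m. \<forall>s<2. measure (uniform_measure lborel (ball (c j) r)) (label_union K lab s) = 1 / 2"
    using equipartitionable_balls[OF assms r(1), of c] by blast
  have half: "measure (uniform_measure lborel (ball (c j) r)) (label_union K lab s) = 1 / 2" if "j < m" "s < 2" for j s
    using K(4) that by blast
  note hit = uniform_ball_half[OF r(1) label_union_borel[OF K(1)] half]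
  have l: "lab 0 < 2" "lab 1 < 2" using K(3) by auto
  have l2: "i < 2 \<longleftrightarrow> i = 0 \<or> i = 1" for i :: nat by auto
  \<comment> \<open>Equal labels would leave the other class empty, without its half of a
    ball.\<close>
  have ne: "lab 0 \<noteq> lab 1"
  proof
    assume eq: "lab 0 = lab 1"
    have "1 - lab 0 \<noteq> lab 0" by arith
    then have "label_union K lab (1 - lab 0) = {}"
      unfolding label_union_def K(2) l2 using eq l by auto
    moreover have "1 - lab 0 < 2" by simp
    ultimately show False using hit(1)[of 0 "1 - lab 0"] m by simp
  qed
  have "label_union K lab (lab i) = K ! i" if "i < 2" for i
  proof -
    have "{i'. i' < length K \<and> lab i' = lab i} = {i}"
      unfolding K(2) l2 using that ne by (auto simp: l2)
    then show ?thesis by (simp add: label_union_def)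
  qed
  then have hitK: "K ! i \<inter> ball (c j) r \<noteq> {}" if "i < 2" "j < m" for i j
    using hit(1)[OF that(2), of "lab i"] K(3) that by auto
  have K01: "K = [K ! 0, K ! 1]" using K(2) by (auto simp: numeral_2_eq_2 length_Suc_conv)
  obtain A B where AB: "halfspace_pair A B" "mset K = {#A, B#}"
    using cut_partition_two[OF K(1)] K(2) by blast
  have "A \<in># mset K" "B \<in># mset K" unfolding AB(2) by auto
  then have hitAB: "A \<inter> ball (c j) r \<noteq> {}" "B \<inter> ball (c j) r \<noteq> {}" if "j < m" for j
    using hitK[OF _ that] K(2) by (auto simp: in_set_conv_nth)
  \<comment> \<open>Nonempty parts exclude the degenerate cuts.\<close>
  have "A \<noteq> {}" "B \<noteq> {}" using hitAB[of 0] m by auto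
  then obtain a b where a: "a \<noteq> 0" "A = {x. b \<le> a \<bullet> x}" "B = {x. a \<bullet> x \<le> b}"
    using AB(1) unfolding halfspace_pair_def by blast
  have near: "\<bar>a \<bullet> c j - b\<bar> \<le> r * norm a" if j: "j < m" for j
  proof -
    obtain x y where x: "b \<le> a \<bullet> x" "x \<in> ball (c j) r" and y: "a \<bullet> y \<le> b" "y \<in> ball (c j) r"
      using hitAB[OF j] unfolding a by blast
    show ?thesis using inner_ball[OF x(2), of a] inner_ball[OF y(2), of a] x(1) y(1) by linarith
  qed
  have b: "\<bar>b\<bar> \<le> r * norm a" using near[OF m] by (simp add: c_def)
  have "\<bar>a \<bullet> v\<bar> \<le> 2 * r * norm a" if "v \<in> Basis" for v
  proof -
    obtain j where "j < ?d" "v = e j" using \<open>v \<in> Basis\<close> e by (auto simp: bij_betw_def)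
    then have "\<bar>a \<bullet> v - b\<bar> \<le> r * norm a" using near[of j] m by (simp add: c_def)
    then show ?thesis using b by linarith
  qed
  then show False using norm_less_if_small_coords[OF a(1), of "2 * r"] r(2) by auto
qed

section \<open>The line\<close>

lemma cut_partition_cover: "cut_partition P \<Longrightarrow> \<Union>(set P) = UNIV"
proof (induction rule: cut_partition.induct)
  case base
  then show ?case by simp
next
  case (step P i A B)
  have AB: "A \<union> B = UNIV" using step.hyps(3) unfolding halfspace_pair_def by auto
  show ?case
  proof (rule set_eqI)
    fix x
    obtain k where k: "k < length P" "x \<in> P ! k"
      using step.IH by (metis UNIV_I UnionE in_set_conv_nth)
    let ?Q = "P[i := P ! i \<inter> A] @ [P ! i \<inter> B]"
    have "\<exists>X\<in>set ?Q. x \<in> X"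
    proof (cases "k = i \<and> x \<notin> A")
      case True
      then show ?thesis using AB k by auto
    next
      case False
      then have "x \<in> P[i := P ! i \<inter> A] ! k" using k by (cases "k = i") auto
      then show ?thesis using k by (metis UnCI length_list_update nth_mem set_append)
    qed
    then show "x \<in> \<Union>(set ?Q) \<longleftrightarrow> x \<in> UNIV" by blast
  qed
next
  case (reorder P Q)
  then show ?case by (metis mset_eq_setD)
qed

text \<open>Each of \<open>n\<close> balls contains points of either class alone. Two from the first
  ball and one from each ball after it, with a suitable choice of labels, would be \<open>n\<close>
  parts' worth plus one: \<open>n + 1\<close> increasing points of alternating labels. Two of them
  in one part would by convexity put the successor of the lower one into that part, against its
  label.\<close>

lemma equipartitionable_line_le:
  assumes "equipartitionable n 2 TYPE('a::euclidean_space) m" "DIM('a) = 1" "1 \<le> n"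
  shows "m \<le> n - 1"
proof (rule ccontr)
  assume "\<not> m \<le> n - 1"
  then have m: "n \<le> m" using assms(3) by simp
  obtain e :: 'a where e: "Basis = {e}"
    using assms(2) by (auto simp: card_1_singleton_iff)
  have e1: "e \<bullet> e = 1" by (rule inner_same_Basis) (simp add: e)
  have eqI: "x = y" if "e \<bullet> x = e \<bullet> y" for x y :: 'a
  proof (rule euclidean_eqI)
    fix b :: 'a assume "b \<in> Basis"
    then have "b = e" unfolding e by simp
    then show "x \<bullet> b = y \<bullet> b" using that by (simp only: inner_commute[of _ e])
  qed
  \<comment> \<open>Balls of radius 1/4 around different integers are disjoint and ordered.\<close>
  define c where "c j = real j *\<^sub>R e" for j
  obtain K lab where K: "cut_partition K" "length K = n" "\<forall>i<n. lab i < 2"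
    "\<forall>j<m. \<forall>s<2. measure (uniform_measure lborel (ball (c j) (1/4))) (label_union K lab s) = 1 / 2"
    using equipartitionable_balls[OF assms(1), of "1/4" c] by auto
  let ?V = "label_union K lab"
  have "?V 0 \<union> ?V 1 = UNIV"
  proof (rule set_eqI)
    fix x
    obtain i where i: "i < n" "x \<in> K ! i"
      using cut_partition_cover[OF K(1)] K(2) by (metis UNIV_I UnionE in_set_conv_nth)
    then have "lab i = 0 \<or> lab i = 1" using K(3) by (auto simp: less_2_cases_iff)
    then show "x \<in> ?V 0 \<union> ?V 1 \<longleftrightarrow> x \<in> UNIV" using i K(2) by (auto simp: label_union_def)
  qed
  then have cover: "?V s \<union> ?V (1 - s) = UNIV" if "s < 2" for s
    using that by (auto simp: less_2_cases_iff)
  \<comment> \<open>Closed parts may overlap in their borders, so the point is taken outside the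
    other class, whose complement has measure 1/2.\<close>
  have "\<exists>x. x \<in> ball (c j) (1/4) \<and> x \<in> ?V s \<and> x \<notin> ?V (1 - s)" if j: "j < n" and s: "s < 2" for j s
  proof -
    let ?mu = "uniform_measure lborel (ball (c j) (1/4))"
    have mu: "ac_prob_measure ?mu" by (rule ac_prob_uniform_ball) simp
    interpret prob_space ?mu using mu by (simp add: ac_prob_measure_def)
    have V: "?V s \<in> sets borel" for s by (rule label_union_borel[OF K(1)])
    have "- ?V (1 - s) = space ?mu - ?V (1 - s)" by auto
    then have "measure ?mu (- ?V (1 - s)) = 1 - measure ?mu (?V (1 - s))"
      using prob_compl[of "?V (1 - s)"] V by simp
    also have "\<dots> = 1 / 2" using K(4) j m s by auto
    finally have h: "measure ?mu (- ?V (1 - s)) = 1 / 2" .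
    have "- ?V (1 - s) \<inter> ball (c j) (1/4) \<noteq> {}"
      by (rule uniform_ball_half(1)[OF _ _ h]) (use V in auto)
    then show ?thesis using cover[OF s] by blast
  qed
  then obtain pt where pt: "\<And>j s. j < n \<Longrightarrow> s < 2 \<Longrightarrow> pt j s \<in> ball (c j) (1/4)"
    "\<And>j s. j < n \<Longrightarrow> s < 2 \<Longrightarrow> pt j s \<in> ?V s" "\<And>j s. j < n \<Longrightarrow> s < 2 \<Longrightarrow> pt j s \<notin> ?V (1 - s)"
    by metis
  have near: "\<bar>e \<bullet> pt j s - real j\<bar> \<le> 1/4" if "j < n" "s < 2" for j s
    using inner_ball[OF pt(1)[OF that], of e] e1 by (simp add: c_def norm_eq_sqrt_inner)
  have n0: "0 < n" using assms(3) by simp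
  have "pt 0 0 \<noteq> pt 0 1" using pt(2)[OF n0, of 0] pt(3)[OF n0, of 1] by auto
  then have "e \<bullet> pt 0 0 \<noteq> e \<bullet> pt 0 1" using eqI by blast
  \<comment> \<open>The label of the lower point in the first ball fixes the start of the
    alternation.\<close>
  then obtain s0 where s0: "s0 < 2" "e \<bullet> pt 0 s0 < e \<bullet> pt 0 (1 - s0)"
    by (metis One_nat_def cancel_comm_monoid_add_class.diff_cancel diff_zero linorder_neqE one_less_numeral_iff pos2 semiring_norm(76))
  \<comment> \<open>Indices 0 and 1 both belong to ball 0; in general index \<open>Suc j\<close>
    belongs to ball \<open>j\<close>.\<close>
  define x where "x i = (case i of 0 \<Rightarrow> pt 0 s0 | Suc j \<Rightarrow> pt j ((s0 + Suc j) mod 2))" for i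
  have xV: "x i \<in> ?V ((s0 + i) mod 2)" "x i \<notin> ?V (1 - (s0 + i) mod 2)" if "i \<le> n" for i
    using that n0 s0(1) pt(2,3) by (auto simp: x_def split: nat.split)
  have inc: "e \<bullet> x i < e \<bullet> x (Suc i)" if i: "i < n" for i
  proof (cases i)
    case 0
    have "Suc s0 mod 2 = 1 - s0" using s0(1) by (auto simp: less_2_cases_iff)
    then show ?thesis using s0 0 by (simp add: x_def)
  next
    case (Suc j)
    have "\<bar>e \<bullet> pt j ((s0 + Suc j) mod 2) - real j\<bar> \<le> 1/4"
      "\<bar>e \<bullet> pt (Suc j) ((s0 + Suc (Suc j)) mod 2) - real (Suc j)\<bar> \<le> 1/4"
      using i Suc by (intro near; simp)+
    then show ?thesis unfolding Suc x_def nat.case of_nat_Suc by linarith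
  qed
  have mono: "e \<bullet> x i \<le> e \<bullet> x k" if "i \<le> k" "k \<le> n" for i k
    using that
  proof (induction k rule: dec_induct)
    case (step k)
    then show ?case using inc[of k] by simp
  qed simp
  have "\<exists>q<n. x i \<in> K ! q \<and> lab q = (s0 + i) mod 2" if "i \<le> n" for i
    using xV(1)[OF that] K(2) by (auto simp: label_union_def)
  then obtain q where q: "\<And>i. i \<le> n \<Longrightarrow> q i < n" "\<And>i. i \<le> n \<Longrightarrow> x i \<in> K ! q i"
    "\<And>i. i \<le> n \<Longrightarrow> lab (q i) = (s0 + i) mod 2"
    by metis
  have distinct: "q i \<noteq> q k" if ik: "i < k" "k \<le> n" for i k
  proof
    assume eq: "q i = q k"
    have "convex (K ! q i)"
      using cut_partition_closed_convex[OF K(1)] q(1)[of i] ik K(2) by simp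
    then have "is_interval ((\<bullet>) e ` (K ! q i))"
      using convex_linear_image[OF bounded_linear.linear[OF bounded_linear_inner_right]]
      by (simp add: is_interval_convex_1)
    moreover have "e \<bullet> x i \<in> (\<bullet>) e ` (K ! q i)" "e \<bullet> x k \<in> (\<bullet>) e ` (K ! q i)"
      using q(2)[of i] q(2)[of k] ik eq by auto
    moreover have "e \<bullet> x i \<le> e \<bullet> x (Suc i)" "e \<bullet> x (Suc i) \<le> e \<bullet> x k"
      using ik by (auto intro: mono)
    ultimately have "e \<bullet> x (Suc i) \<in> (\<bullet>) e ` (K ! q i)"
      unfolding is_interval_1 by blast
    then have "x (Suc i) \<in> K ! q i" using eqI by auto
    then have "x (Suc i) \<in> ?V ((s0 + i) mod 2)"
      using q(1)[of i] q(3)[of i] ik K(2) by (auto simp: label_union_def)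
    moreover have "1 - (s0 + Suc i) mod 2 = (s0 + i) mod 2" by presburger
    ultimately show False using xV(2)[of "Suc i"] ik by simp
  qed
  have "inj_on q {..n}"
    by (rule linorder_inj_onI) (use distinct in auto)
  moreover have "q ` {..n} \<subseteq> {..<n}" using q(1) by auto
  ultimately have "card {..n} \<le> card {..<n}" by (intro card_inj_on_le) auto
  then show False by simp
qed

theorem theorem2:
  shows "(\<forall>t::nat. t \<ge> 1 \<longrightarrow> enat (t * (DIM('a::euclidean_space) + 1) - 1) \<le> Mpp (2 * t) 2 TYPE('a))
    \<and> (\<forall>t::nat. enat (t * (DIM('a) + 1)) \<le> Mpp (2 * t + 1) 2 TYPE('a))
    \<and> (DIM('a) = 1 \<longrightarrow> (\<forall>n::nat. n \<ge> 1 \<longrightarrow> Mpp n 2 TYPE('a) = enat (n - 1)))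
    \<and> Mpp 3 2 TYPE('a) = enat (DIM('a) + 1)
    \<and> Mpp 2 2 TYPE('a) = enat DIM('a)"
proof (intro conjI allI impI)
  let ?d = "DIM('a)"
  have even: "enat (t * (?d + 1) - 1) \<le> Mpp (2 * t) 2 TYPE('a)" if "1 \<le> t" for t
    using that equipartitionable_slabs_ge[where 'a = 'a, of t t] by (intro le_Mpp) (simp add: mult_2)
  have odd: "enat (t * (?d + 1)) \<le> Mpp (2 * t + 1) 2 TYPE('a)" for t
    using equipartitionable_slabs_ge[where 'a = 'a, of "Suc t" t] by (intro le_Mpp) (simp add: mult_2)
  show "enat (t * (?d + 1) - 1) \<le> Mpp (2 * t) 2 TYPE('a)" if "1 \<le> t" for t
    by (rule even[OF that])
  show "enat (t * (?d + 1)) \<le> Mpp (2 * t + 1) 2 TYPE('a)" for t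
    by (rule odd)
  show "Mpp n 2 TYPE('a) = enat (n - 1)" if d: "?d = 1" and n: "1 \<le> n" for n
  proof (rule antisym)
    show "Mpp n 2 TYPE('a) \<le> enat (n - 1)"
      by (rule Mpp_le) (rule equipartitionable_line_le[OF _ d n])
    show "enat (n - 1) \<le> Mpp n 2 TYPE('a)"
    \<comment> \<open>For \<open>?d = 1\<close> the two lower bounds are \<open>2 * t - 1\<close>
      and \<open>2 * t\<close>, which is \<open>n - 1\<close> in either case.\<close>
    proof (cases "even n")
      case True
      then obtain t where t: "n = 2 * t" by (elim evenE)
      then show ?thesis using even[of t] n unfolding d by (simp add: mult_2)
    next
      case False
      then obtain t where t: "n = 2 * t + 1" by (elim oddE)
      then show ?thesis using odd[of t] unfolding d by (simp add: mult_2)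
    qed
  qed
  show "Mpp 3 2 TYPE('a) = enat (?d + 1)"
  proof (rule antisym)
    show "Mpp 3 2 TYPE('a) \<le> enat (?d + 1)"
      by (rule Mpp_le) (rule equipartitionable_three_le)
    show "enat (?d + 1) \<le> Mpp 3 2 TYPE('a)" using odd[of 1] by simp
  qed
  show "Mpp 2 2 TYPE('a) = enat ?d"
  proof (rule antisym)
    show "Mpp 2 2 TYPE('a) \<le> enat ?d"
      by (rule Mpp_le) (rule equipartitionable_two_le)
    show "enat ?d \<le> Mpp 2 2 TYPE('a)" using even[of 1] by simp
  qed
qed

end
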